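(* Assume the regression setting, sieve prior $\tilde\pi=\sum_{j\in J}a_j\tilde\pi_j$ and notation described in the context, with $\|f_o\|_\infty\le M$. Suppose that $\|f_{\theta,j}\|_\infty\le M$ for all $j\in J$ and $\theta\in\Theta_j$, and that the following six assumptions hold. (1) For each $j\in J$ there exist constants $A_j\ge0.0056$ and $m_j\ge1$ such that for any $r>0$, $0<\delta\le0.0056\,r$ and $\theta\in\Theta_j$, $$N(B_{L_2(\mu_X),j}(\theta,r),\delta,d_{j,\infty})\le\left(\frac{A_jr}{\delta}\right)^{m_j}.$$ With these $A_j,m_j$, and constants $C_j\ge0$ with $\sum_{j\in J}e^{-C_j}\le1$, put $$\eta_j=\frac{4m_j}{c_{1,M,\sigma}(1-4\gamma)}\log(1072.5A_j)+C_j\max\left(1,\frac{8}{c_{1,M,\sigma}(1-4\gamma)}\right),$$ $$a_j=\alpha\exp\left(-\left(1+\frac1{2\sigma^2}+\frac{0.0056}{\sigma}\right)\eta_j\right),$$ where $\alpha$ is the normalizing constant such that $\sum_{j\in J} a_j=1$, and $c_{1,M,\sigma}$ and $\gamma$ are the constants given in the context. (2) There exist $j_n\in J$, $\beta_n\in\Theta_{j_n}$ and a sequence $\{\varepsilon_n\}$ of positive numbers such that $$\max\bigl(D(p_{f_o}\|p_{f_{\beta_n,j_n}}),V(p_{f_o}\|p_{f_{\beta_n,j_n}})\bigr)+\frac{\eta_{j_n}}n\le\varepsilon_n^2 .$$ (3) For each such $j_n$ there exists a metric $d_{j_n}$ on $\Theta_{j_n}$ such that $\|f_{\theta,j_n}-f_{\eta,j_n}\|^2_{L_2(\mu_X)}\le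 K_0'\,d_{j_n}^2(\theta,\eta)$ for all $\theta,\eta\in\Theta_{j_n}$, where $K_0'$ is a constant independent of $n$. (4) There exist constants $b_1\ge0$ and $K_4$, independent of $n$, such that $N(\Theta_{j_n},\varepsilon_n,d_{j_n})\le(A_{j_n}^{b_1}K_4)^{m_{j_n}}$. (5) There exist constants $b_2\ge0$ and $K_5$, independent of $n$, such that for any $\theta_1\in\Theta_{j_n}$, $$\frac{\pi_{j_n}(B_{d_{j_n},j_n}(\theta_1,\varepsilon_n))}{\pi_{j_n}(B_{d_{j_n},j_n}(\beta_n,\varepsilon_n))}\le(A_{j_n}^{b_2}K_5)^{m_{j_n}} .$$ (6) $\varepsilon_n\to0$ and $n\varepsilon_n^2\to\infty$ as $n\to\infty$. Then, with the weights $a_j=\alpha\exp\left(-\left(1+\frac1{2\sigma^2}+\frac{0.0056}{\sigma}\right)\eta_j\right)$, $j\in J$, in the sieve prior $\tilde\pi=\sum_{j\in J}a_j\tilde\pi_j$, there exists a positive constant $K_1$ (independent of $n$) such that the posterior probability $$\tilde\pi\bigl(\tilde B_{L_2(\mu_X)}(K_1\varepsilon_n)^c\mid (X_1,Y_1),\dots,(X_n,Y_n)\bigr)$$ converges to zero in $P_{f_o}^n$-probability as $n\to\infty$.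
   Context: Setting. The data are i.i.d. pairs $(X_i,Y_i)$, $i=1,\dots,n$, with $Y_i=f_o(X_i)+\varepsilon_i$ (the noise variables $\varepsilon_i$ carry the data index and are distinct from the rate sequence $\{\varepsilon_n\}$), where $X_i$ and $\varepsilon_i$ are independent, $X_i$ has distribution $\mu_X$ (a probability measure), $\varepsilon_i\sim N(0,\sigma^2)$ with known variance $\sigma^2>0$, and $f_o$ is the true regression function, satisfying $\|f_o\|_\infty\le M$ for a known constant $M>0$. $P_{f_o}^n$ is the joint law of the data. For a regression function $f$, the density of $(X_i,Y_i)$ with respect to $\mu_X\times$ Lebesgue measure is $p_f(x,y)=\frac1{\sqrt{2\pi}\sigma}e^{-(y-f(x))^2/(2\sigma^2)}$. $J$ is a countable index set. For each $j\in J$, $\Theta_j$ is a (finite-dimensional) parameter space, $\{f_{\theta,j}:\theta\in\Theta_j\}$ is a family of regression functions, $\pi_j$ is a prior probability measure on $\Theta_j$, and $\tilde\pi_j$ is the prior it induces on functions via $\theta\mapsto f_{\theta,j}$. The sieve prior is $\tilde\pi=\sum_{j}a_j\tilde\pi_j$. $\tilde B_{L_2(\mu_X)}(s)=\{f:\|f-f_o\|_{L_2(\mu_X)}\le s\}$ (among functions in $\bigcup_j\{f_{\theta,j}:\theta\in\Theta_j\}$), and the posterior probability of its complement is $$\frac{\sum_ja_j\int_{\{\theta\in\Theta_j:\|f_{\theta,j}-f_o\|_{L_2(\mu_X)}>s\}}\prod_{i=1}^n\frac{p_{f_{\theta,j}}(X_i,Y_i)}{p_{f_o}(X_i,Y_i)}d\pi_j(\theta)}{\sum_ja_j\int_{\Theta_j}\prod_{i=1}^n\frac{p_{f_{\theta,j}}(X_i,Y_i)}{p_{f_o}(X_i,Y_i)}d\pi_j(\theta)}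 .$$ Constants. $c_{1,M,\sigma}=\min\left(\frac{1-\exp(-M^2/(2\sigma^2))}{2M^2},\frac1{2\sigma^2}\right)$; $c_{2,c_0,M}=2(c_0+2M)$ with $c_0=2\sigma$; and $\gamma\in(0,0.25)$ is defined by $0.0056=\frac{0.13}{c_{2,c_0,M}\sqrt{c_{1,M,\sigma}}}\cdot\frac{\gamma}{\sqrt{1-4\gamma}}$. Notation. $B_{L_2(\mu_X),j}(\eta,r)=\{\theta\in\Theta_j:\|f_{\eta,j}-f_{\theta,j}\|_{L_2(\mu_X)}\le r\}$. $d_{j,\infty}(\theta,\eta)=\|f_{\theta,j}-f_{\eta,j}\|_\infty$ (sup norm). For a metric $d'$, $N(B,\delta,d')$ is the smallest number of $d'$-balls of radius $\delta$ needed to cover $B$. For densities $p,q$ with respect to $\nu=\mu_X\times$ Lebesgue measure, $D(p\|q)=\int p\log(p/q)\,d\nu$ and $V(p\|q)=\int p(\log(p/q))^2d\nu$. $B_{d_{j_n},j_n}(\theta,\varepsilon)$ is the $d_{j_n}$-ball in $\Theta_{j_n}$ centered at $\theta$ with radius $\varepsilon$. *)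

theory Defs
  imports "HOL-Probability.Probability"
begin

definition c1 :: "real \<Rightarrow> real \<Rightarrow> real" where
  "c1 M \<sigma> = min ((1 - exp (- (M^2) / (2 * \<sigma>^2))) / (2 * M^2)) (1 / (2 * \<sigma>^2))"

text \<open>This is $c_{2,c_0,M} = 2(c_0+2M)$ at $c_0 = 2\sigma$.\<close>

definition c2 :: "real \<Rightarrow> real \<Rightarrow> real" where
  "c2 M \<sigma> = 2 * (2 * \<sigma> + 2 * M)"

definition complexity :: "real \<Rightarrow> real \<Rightarrow> real \<Rightarrow> real \<Rightarrow> real \<Rightarrow> real \<Rightarrow> real" where
  "complexity M \<sigma> \<gamma> A m C =
     4 * m / (c1 M \<sigma> * (1 - 4 * \<gamma>)) * ln (1072.5 * A)
     + C * max 1 (8 / (c1 M \<sigma> * (1 - 4 * \<gamma>)))"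

definition L2_dist :: "'x measure \<Rightarrow> ('x \<Rightarrow> real) \<Rightarrow> ('x \<Rightarrow> real) \<Rightarrow> real" where
  "L2_dist \<mu> f g = sqrt (LINT x|\<mu>. (f x - g x)^2)"

text \<open>The supremum is over all points of the space, not an essential supremum. It is a
  supremum of reals, hence only meaningful when the difference is bounded.\<close>

definition sup_dist :: "'x measure \<Rightarrow> ('x \<Rightarrow> real) \<Rightarrow> ('x \<Rightarrow> real) \<Rightarrow> real" where
  "sup_dist \<mu> f g = (SUP x\<in>space \<mu>. \<bar>f x - g x\<bar>)"

text \<open>Closed balls inside a parameter space. The distance need not separate points, because
  different parameters may give the same regression function.\<close>

definition pball :: "'p set \<Rightarrow> ('p \<Rightarrow> 'p \<Rightarrow> real) \<Rightarrow> 'p \<Rightarrow> real \<Rightarrow> 'p set" where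
  "pball T d \<theta> r = {\<eta>\<in>T. d \<theta> \<eta> \<le> r}"

text \<open>The centres of the covering balls lie in the parameter space \<open>T\<close>, not necessarily in the
  covered set \<open>B\<close>. The value is \<open>\<infinity>\<close> if there is no finite cover.\<close>

definition covering_number ::
  "'p set \<Rightarrow> 'p set \<Rightarrow> real \<Rightarrow> ('p \<Rightarrow> 'p \<Rightarrow> real) \<Rightarrow> enat" where
  "covering_number T B \<delta> d =
     Inf {enat (card S) |S. finite S \<and> S \<subseteq> T \<and> B \<subseteq> (\<Union>\<theta>\<in>S. pball T d \<theta> \<delta>)}"

definition reg_density :: "real \<Rightarrow> ('x \<Rightarrow> real) \<Rightarrow> 'x \<times> real \<Rightarrow> real" where
  "reg_density \<sigma> f = (\<lambda>(x, y). normal_density (f x) \<sigma> y)"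

definition KL_div :: "'a measure \<Rightarrow> ('a \<Rightarrow> real) \<Rightarrow> ('a \<Rightarrow> real) \<Rightarrow> real" where
  "KL_div \<nu> p q = (LINT z|\<nu>. p z * ln (p z / q z))"

definition KL_var :: "'a measure \<Rightarrow> ('a \<Rightarrow> real) \<Rightarrow> ('a \<Rightarrow> real) \<Rightarrow> real" where
  "KL_var \<nu> p q = (LINT z|\<nu>. p z * (ln (p z / q z))^2)"

text \<open>Joint law of the $n$ i.i.d. pairs $(X_i, f_o(X_i) + e_i)$, with $X_i$ distributed as
  \<open>\<mu>\<close> and independent noise $e_i \sim N(0,\sigma^2)$.\<close>

definition data_law ::
  "'x measure \<Rightarrow> real \<Rightarrow> ('x \<Rightarrow> real) \<Rightarrow> nat \<Rightarrow> (nat \<Rightarrow> 'x \<times> real) measure" where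
  "data_law \<mu> \<sigma> f0 n =
     Pi\<^sub>M {..<n} (\<lambda>_. distr (\<mu> \<Otimes>\<^sub>M density lborel (normal_density 0 \<sigma>)) (\<mu> \<Otimes>\<^sub>M borel)
                       (\<lambda>(x, e). (x, f0 x + e)))"

definition lik_ratio ::
  "real \<Rightarrow> ('x \<Rightarrow> real) \<Rightarrow> ('x \<Rightarrow> real) \<Rightarrow> nat \<Rightarrow> (nat \<Rightarrow> 'x \<times> real) \<Rightarrow> real" where
  "lik_ratio \<sigma> f0 g n z = (\<Prod>i<n. reg_density \<sigma> g (z i) / reg_density \<sigma> f0 (z i))"

text \<open>Posterior probability, under the sieve prior with weights \<open>a\<close>, of the functions at
  $L_2(\mu)$-distance more than \<open>s\<close> from \<open>f0\<close>, given the data \<open>z\<close>. The parameter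
  space of model \<open>j\<close> is \<open>space (prior j)\<close>.\<close>

definition posterior_far ::
  "'x measure \<Rightarrow> real \<Rightarrow> ('x \<Rightarrow> real) \<Rightarrow> 'j set \<Rightarrow> ('j \<Rightarrow> real) \<Rightarrow> ('j \<Rightarrow> 'p measure)
   \<Rightarrow> ('j \<Rightarrow> 'p \<Rightarrow> 'x \<Rightarrow> real) \<Rightarrow> real \<Rightarrow> nat \<Rightarrow> (nat \<Rightarrow> 'x \<times> real) \<Rightarrow> real" where
  "posterior_far \<mu> \<sigma> f0 J a prior f s n z =
     (\<Sum>\<^sub>\<infinity>j\<in>J. a j * (LINT \<theta>:{\<theta>\<in>space (prior j). L2_dist \<mu> (f j \<theta>) f0 > s}|prior j.
                        lik_ratio \<sigma> f0 (f j \<theta>) n z))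
     / (\<Sum>\<^sub>\<infinity>j\<in>J. a j * (LINT \<theta>|prior j. lik_ratio \<sigma> f0 (f j \<theta>) n z))"

end

theory Submission imports Defs begin

text \<open>Every bound below has the form \<open>exp (- c \<tau>)\<close> with \<open>\<tau> = n \<epsilon>\<^sub>n\<^sup>2 \<rightarrow> \<infinity>\<close>. Exponential moments of
  Gaussian log-likelihood ratios are explicit and, as all regression functions are bounded by
  \<open>M\<close>, comparable to squared \<open>L\<^sub>2\<close> distances. The denominator of the posterior is bounded below on
  the prior ball around \<open>\<beta>\<^sub>n\<close>, whose mass is at least \<open>exp (- c \<tau>)\<close> by the covering and
  prior-ratio assumptions. In the numerator, the models with \<open>\<eta>\<^sub>j \<ge> L \<tau>\<close> contribute little in mean
  because of their weights. There are at most \<open>exp (L \<tau>)\<close> other models; each is cut into dyadic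
  \<open>L\<^sub>2\<close> shells around \<open>f\<^sub>0\<close>, covered by sup-norm balls, and for each centre the likelihood ratio
  test separates the whole ball from \<open>f\<^sub>0\<close>. Choosing \<open>K\<^sub>1\<close> large makes the test errors beat both the
  number of centres and the lower bound for the denominator.\<close>

text \<open>The exact moments are exponentials of pointwise squares \<open>(g x - f0 x)^2\<close>,
  averaged over the covariate. Only on a bounded range are such exponentials dominated by functions
  linear in the square, and linearity is what brings in L2 distances: \<open>\<rho>\<close> does
  this for negative exponents, \<open>chi_const\<close> for positive ones. The covers are in sup
  norm because the error of a centre's test at a neighbouring function is estimated pointwise in the
  covariate. The cover radius is a fixed fraction of the shell radius, so the entropy assumption
  gives the same number of centres for every shell while the errors decrease geometrically;
  infinitely many shells then cost no more than a constant factor. The weight exponent is split as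
  \<open>(1 + w) * \<eta> j\<close>: one \<open>\<eta> j\<close> pays for summation over the models
  through \<open>exp (- C j)\<close>, and the surplus \<open>w * \<eta> j\<close> outweighs the loss
  in the denominator once the complexity is large. There is no circularity: the cost of the
  denominator depends neither on the cutoff \<open>L\<close> nor on \<open>K1\<close>, and
  \<open>L\<close> does not depend on \<open>K1\<close>.\<close>

text \<open>A real bound excludes the value \<open>\<infinity>\<close>, so the set of admissible
  cardinalities is nonempty, and a nonempty set of extended naturals attains its infimum.\<close>

lemma covering_number_le_obtain:
  assumes "ereal_of_enat (covering_number T B \<delta> d) \<le> ereal r"
  obtains S where "finite S" "S \<subseteq> T" "B \<subseteq> (\<Union>\<theta>\<in>S. pball T d \<theta> \<delta>)" "real (card S) \<le> r"
proof -
  let ?F = "{enat (card S) |S. finite S \<and> S \<subseteq> T \<and> B \<subseteq> (\<Union>\<theta>\<in>S. pball T d \<theta> \<delta>)}"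
  have "?F \<noteq> {}"
  proof
    assume "?F = {}"
    then have "covering_number T B \<delta> d = \<infinity>"
      by (simp only: covering_number_def Inf_enat_def) simp
    with assms show False by simp
  qed
  then have "Inf ?F \<in> ?F"
    by (meson ex_in_conv wellorder_InfI)
  then obtain S where S: "finite S" "S \<subseteq> T" "B \<subseteq> (\<Union>\<theta>\<in>S. pball T d \<theta> \<delta>)"
    and "covering_number T B \<delta> d = enat (card S)"
    unfolding covering_number_def by blast
  with assms have "real (card S) \<le> r" by simp
  with S that show ?thesis by blast
qed

text \<open>A real \<open>SUP\<close> dominates the individual values only when they are bounded
  above; the uniform bound \<open>M\<close> provides this.\<close>

lemma pball_sup_distD:
  assumes "\<eta> \<in> pball T (\<lambda>\<theta> \<eta>. sup_dist \<mu> (f \<theta>) (f \<eta>)) \<theta> \<delta>"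
    and "\<And>\<theta> x. \<theta> \<in> T \<Longrightarrow> x \<in> space \<mu> \<Longrightarrow> \<bar>f \<theta> x\<bar> \<le> M"
    and "\<theta> \<in> T" "x \<in> space \<mu>"
  shows "\<bar>f \<theta> x - f \<eta> x\<bar> \<le> \<delta>"
proof -
  have eta: "\<eta> \<in> T" "sup_dist \<mu> (f \<theta>) (f \<eta>) \<le> \<delta>"
    using assms(1) by (auto simp: pball_def)
  have "bdd_above ((\<lambda>x. \<bar>f \<theta> x - f \<eta> x\<bar>) ` space \<mu>)"
  proof (rule bdd_aboveI2)
    fix x assume "x \<in> space \<mu>"
    then show "\<bar>f \<theta> x - f \<eta> x\<bar> \<le> 2 * M"
      using assms(2)[OF \<open>\<theta> \<in> T\<close>] assms(2)[OF eta(1)] by (smt (verit))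
  qed
  then have "\<bar>f \<theta> x - f \<eta> x\<bar> \<le> sup_dist \<mu> (f \<theta>) (f \<eta>)"
    unfolding sup_dist_def by (intro cSUP_upper assms(4))
  with eta show ?thesis by simp
qed

section \<open>Exponential moments of Gaussian noise\<close>

text \<open>Exponential tilting: completing the square turns the factor \<open>exp (t * e)\<close>
  into a shift of the mean by \<open>t * \<sigma>^2\<close>.\<close>

lemma normal_density_times_exp:
  assumes "\<sigma> > 0"
  shows "normal_density 0 \<sigma> e * exp (t * e) = exp (t^2 * \<sigma>^2 / 2) * normal_density (t * \<sigma>^2) \<sigma> e"
proof -
  have "- (e^2) / (2 * \<sigma>^2) + t * e = t^2 * \<sigma>^2 / 2 + - ((e - t * \<sigma>^2)^2) / (2 * \<sigma>^2)"
    using assms by (simp add: field_simps power2_eq_square)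
  then have "exp (- (e^2) / (2 * \<sigma>^2)) * exp (t * e)
      = exp (t^2 * \<sigma>^2 / 2) * exp (- ((e - t * \<sigma>^2)^2) / (2 * \<sigma>^2))"
    by (simp only: exp_add[symmetric])
  then show ?thesis
    by (simp add: normal_density_def)
qed

lemma nn_integral_exp_normal:
  assumes "\<sigma> > 0"
  shows "(\<integral>\<^sup>+e. ennreal (exp (t * e)) \<partial>density lborel (\<lambda>e. ennreal (normal_density 0 \<sigma> e)))
    = ennreal (exp (t^2 * \<sigma>^2 / 2))"
proof -
  have "(\<integral>\<^sup>+e. ennreal (exp (t * e)) \<partial>density lborel (\<lambda>e. ennreal (normal_density 0 \<sigma> e)))
      = (\<integral>\<^sup>+e. ennreal (normal_density 0 \<sigma> e * exp (t * e)) \<partial>lborel)"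
    by (simp add: nn_integral_density ennreal_mult)
  also have "\<dots> = ennreal (exp (t^2 * \<sigma>^2 / 2)) * (\<integral>\<^sup>+e. ennreal (normal_density (t * \<sigma>^2) \<sigma> e) \<partial>lborel)"
    by (simp add: normal_density_times_exp[OF assms] ennreal_mult nn_integral_cmult)
  also have "(\<integral>\<^sup>+e. ennreal (normal_density (t * \<sigma>^2) \<sigma> e) \<partial>lborel) = 1"
    using assms by (subst nn_integral_eq_integral) auto
  finally show ?thesis by simp
qed

text \<open>Logarithm of the density ratio of \<open>g\<close> to \<open>f0\<close> at one
  observation; the variances agree, so the normalising factors cancel and the expression is affine
  in the noise.\<close>

definition log_ratio :: "real \<Rightarrow> ('x \<Rightarrow> real) \<Rightarrow> ('x \<Rightarrow> real) \<Rightarrow> 'x \<times> real \<Rightarrow> real" where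
  "log_ratio \<sigma> f0 g w = ((snd w - f0 (fst w))^2 - (snd w - g (fst w))^2) / (2 * \<sigma>^2)"

lemma reg_density_ratio:
  assumes "\<sigma> > 0"
  shows "reg_density \<sigma> g w / reg_density \<sigma> f0 w = exp (log_ratio \<sigma> f0 g w)"
proof -
  have "exp (log_ratio \<sigma> f0 g w)
      = exp (- ((snd w - g (fst w))^2) / (2 * \<sigma>^2)) / exp (- ((snd w - f0 (fst w))^2) / (2 * \<sigma>^2))"
    unfolding exp_diff[symmetric] log_ratio_def by (simp add: diff_divide_distrib)
  with assms show ?thesis
    by (cases w) (simp add: reg_density_def normal_density_def)
qed

lemma lik_ratio_eq_exp:
  "\<sigma> > 0 \<Longrightarrow> lik_ratio \<sigma> f0 g n z = exp (\<Sum>i<n. log_ratio \<sigma> f0 g (z i))"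
  by (simp add: lik_ratio_def reg_density_ratio exp_sum)

text \<open>Bridge from the real sums in the posterior to integrals over a counting measure, to
  which Tonelli's theorem applies.\<close>

lemma nn_integral_count_space_eq_infsum:
  fixes v :: "'a \<Rightarrow> real"
  assumes "v summable_on A" "\<And>x. x \<in> A \<Longrightarrow> v x \<ge> 0"
  shows "(\<integral>\<^sup>+x. ennreal (v x) \<partial>count_space A) = ennreal (infsum v A)"
proof -
  have "Infinite_Set_Sum.abs_summable_on v A"
    using assms(1) summable_on_iff_abs_summable_on_real abs_summable_equivalent by blast
  then show ?thesis
    using assms(2) by (simp add: nn_integral_conv_infsetsum infsetsum_infsum)
qed

lemma c1_pos:
  assumes "M > 0" "\<sigma> > 0"
  shows "c1 M \<sigma> > 0"
proof -
  have "exp (- (M^2) / (2 * \<sigma>^2)) < 1" using assms by simp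
  then show ?thesis using assms by (simp add: c1_def)
qed

text \<open>Markov's inequality for the counting measure: every index in \<open>J'\<close>
  contributes at least \<open>exp (- x)\<close> to a sum that is at most 1. A common bound on the
  finite subsets already forces \<open>J'\<close> to be finite.\<close>

lemma finite_card_le_of_exp_sum:
  fixes C :: "'j \<Rightarrow> real"
  assumes "(\<lambda>j. exp (- C j)) summable_on J" "(\<Sum>\<^sub>\<infinity>j\<in>J. exp (- C j)) \<le> 1"
    and "J' \<subseteq> J" "\<And>j. j \<in> J' \<Longrightarrow> C j \<le> x"
  shows "finite J' \<and> real (card J') \<le> exp x"
proof -
  have le: "real (card F) \<le> exp x" if F: "F \<subseteq> J'" "finite F" for F
  proof -
    have "real (card F) * exp (- x) = (\<Sum>j\<in>F. exp (- x))" by simp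
    also have "\<dots> \<le> (\<Sum>j\<in>F. exp (- C j))"
      using F assms(4) by (intro sum_mono) auto
    also have "\<dots> \<le> (\<Sum>\<^sub>\<infinity>j\<in>J. exp (- C j))"
      using F assms(1,3) by (intro finite_sum_le_infsum) auto
    finally have "real (card F) * exp (- x) \<le> 1" using assms(2) by linarith
    then show ?thesis by (simp add: exp_minus field_simps)
  qed
  have "finite J'"
    using finite_if_finite_subsets_card_bdd[of J' "nat \<lfloor>exp x\<rfloor>"] le by (simp add: le_nat_floor)
  with le show ?thesis by blast
qed

section \<open>Law of the regression data and joint moments of log-likelihood ratios\<close>

locale gaussian_regression = prob_space \<mu> for \<mu> :: "'x measure" +
  fixes f0 :: "'x \<Rightarrow> real" and \<sigma> M :: real
  assumes sigma_pos: "\<sigma> > 0"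
    and f0_measurable[measurable]: "f0 \<in> borel_measurable \<mu>"
    and f0_bound: "x \<in> space \<mu> \<Longrightarrow> \<bar>f0 x\<bar> \<le> M"
begin

abbreviation "noise \<equiv> density lborel (\<lambda>e. ennreal (normal_density 0 \<sigma> e))"

abbreviation "obs \<equiv> distr (\<mu> \<Otimes>\<^sub>M noise) (\<mu> \<Otimes>\<^sub>M borel) (\<lambda>(x, e). (x, f0 x + e))"

lemma prob_space_noise: "prob_space noise"
  using sigma_pos by (rule prob_space_normal_density)

lemma obs_measurable: "(\<lambda>(x, e). (x, f0 x + e)) \<in> \<mu> \<Otimes>\<^sub>M noise \<rightarrow>\<^sub>M \<mu> \<Otimes>\<^sub>M borel"
proof -
  have [measurable_cong]: "sets noise = sets borel" by simp
  show ?thesis by measurable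
qed

lemma prob_space_obs: "prob_space obs"
proof -
  interpret noise: prob_space noise by (rule prob_space_noise)
  interpret pair_prob_space \<mu> noise ..
  show ?thesis by (rule prob_space_distr[OF obs_measurable])
qed

lemma prob_space_data: "prob_space (data_law \<mu> \<sigma> f0 n)"
  unfolding data_law_def by (intro prob_space_PiM prob_space_obs)

lemma sets_data[measurable_cong]:
  "sets (data_law \<mu> \<sigma> f0 n) = sets (Pi\<^sub>M {..<n} (\<lambda>_. \<mu> \<Otimes>\<^sub>M borel))"
  unfolding data_law_def by (intro sets_PiM_cong) auto

lemma log_ratio_measurable[measurable]:
  assumes [measurable]: "g \<in> borel_measurable \<mu>"
  shows "log_ratio \<sigma> f0 g \<in> borel_measurable (\<mu> \<Otimes>\<^sub>M borel)"
  unfolding log_ratio_def by measurable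

lemma nn_integral_data_prod:
  assumes [measurable]: "h \<in> borel_measurable (\<mu> \<Otimes>\<^sub>M borel)"
  shows "(\<integral>\<^sup>+z. (\<Prod>i<n. h (z i)) \<partial>data_law \<mu> \<sigma> f0 n)
    = (\<integral>\<^sup>+x. \<integral>\<^sup>+e. h (x, f0 x + e) \<partial>noise \<partial>\<mu>) ^ n"
proof -
  interpret noise: prob_space noise by (rule prob_space_noise)
  interpret pair_prob_space \<mu> noise ..
  interpret obs: prob_space obs by (rule prob_space_obs)
  interpret product_sigma_finite "\<lambda>_::nat. obs"
    by unfold_locales
  have [measurable_cong]: "sets noise = sets borel" by simp
  have "(\<integral>\<^sup>+z. (\<Prod>i<n. h (z i)) \<partial>data_law \<mu> \<sigma> f0 n) = (\<integral>\<^sup>+w. h w \<partial>obs) ^ n"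
    unfolding data_law_def by (subst product_nn_integral_prod) auto
  also have "(\<integral>\<^sup>+w. h w \<partial>obs) = (\<integral>\<^sup>+p. h (case p of (x, e) \<Rightarrow> (x, f0 x + e)) \<partial>(\<mu> \<Otimes>\<^sub>M noise))"
    by (subst nn_integral_distr[OF obs_measurable]) auto
  also have "\<dots> = (\<integral>\<^sup>+x. \<integral>\<^sup>+e. h (x, f0 x + e) \<partial>noise \<partial>\<mu>)"
    by (subst noise.nn_integral_fst[symmetric]) auto
  finally show ?thesis .
qed

text \<open>Given the covariate, the exponent is affine in the noise, so the Gaussian moment formula
  applies; independence gives the power \<open>n\<close>. The pairs \<open>(a, b)\<close> used below
  are (1, 0) for the mean, (1/2, 0) and (1, -1/2) for the two errors of a test, and (-1, 0) for the
  evidence.\<close>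

lemma nn_integral_exp_log_ratio:
  assumes [measurable]: "g \<in> borel_measurable \<mu>" "h \<in> borel_measurable \<mu>"
  shows "(\<integral>\<^sup>+z. ennreal (exp (a * (\<Sum>i<n. log_ratio \<sigma> f0 g (z i)) + b * (\<Sum>i<n. log_ratio \<sigma> f0 h (z i))))
      \<partial>data_law \<mu> \<sigma> f0 n)
    = (\<integral>\<^sup>+x. ennreal (exp (((a * (g x - f0 x) + b * (h x - f0 x))^2
        - a * (g x - f0 x)^2 - b * (h x - f0 x)^2) / (2 * \<sigma>^2))) \<partial>\<mu>) ^ n"
proof -
  let ?h = "\<lambda>w. ennreal (exp (a * log_ratio \<sigma> f0 g w + b * log_ratio \<sigma> f0 h w))"
  have inner: "(\<integral>\<^sup>+e. ?h (x, f0 x + e) \<partial>noise) = ennreal (exp (((a * (g x - f0 x) + b * (h x - f0 x))^2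
        - a * (g x - f0 x)^2 - b * (h x - f0 x)^2) / (2 * \<sigma>^2)))" for x
  proof -
    define u v where "u = g x - f0 x" and "v = h x - f0 x"
    let ?c = "(- a * u^2 - b * v^2) / (2 * \<sigma>^2)" and ?t = "(a * u + b * v) / \<sigma>^2"
    have gh: "g x = f0 x + u" "h x = f0 x + v" by (simp_all add: u_def v_def)
    have "a * log_ratio \<sigma> f0 g (x, f0 x + e) + b * log_ratio \<sigma> f0 h (x, f0 x + e) = ?c + ?t * e" for e
      using sigma_pos unfolding log_ratio_def fst_conv snd_conv gh
      by (simp add: field_simps power2_eq_square)
    then have "(\<integral>\<^sup>+e. ?h (x, f0 x + e) \<partial>noise)
        = (\<integral>\<^sup>+e. ennreal (exp ?c) * ennreal (exp (?t * e)) \<partial>noise)"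
      by (simp add: exp_add ennreal_mult)
    also have "\<dots> = ennreal (exp ?c) * ennreal (exp (?t^2 * \<sigma>^2 / 2))"
      by (subst nn_integral_cmult, measurable, simp only: nn_integral_exp_normal[OF sigma_pos])
    also have "\<dots> = ennreal (exp (?c + ?t^2 * \<sigma>^2 / 2))"
      by (simp add: ennreal_mult exp_add)
    also have "?c + ?t^2 * \<sigma>^2 / 2 = ((a * u + b * v)^2 - a * u^2 - b * v^2) / (2 * \<sigma>^2)"
      using sigma_pos by (simp add: field_simps power2_eq_square)
    finally show ?thesis by (simp add: u_def v_def)
  qed
  have "(\<integral>\<^sup>+z. ennreal (exp (a * (\<Sum>i<n. log_ratio \<sigma> f0 g (z i)) + b * (\<Sum>i<n. log_ratio \<sigma> f0 h (z i))))
      \<partial>data_law \<mu> \<sigma> f0 n) = (\<integral>\<^sup>+z. (\<Prod>i<n. ?h (z i)) \<partial>data_law \<mu> \<sigma> f0 n)"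
    by (simp add: sum_distrib_left sum.distrib[symmetric] exp_sum prod_ennreal)
  also have "\<dots> = (\<integral>\<^sup>+x. \<integral>\<^sup>+e. ?h (x, f0 x + e) \<partial>noise \<partial>\<mu>) ^ n"
    by (intro nn_integral_data_prod) measurable
  finally show ?thesis by (simp only: inner)
qed

section \<open>Bounded regression functions and their L2 distance\<close>

definition regfun :: "('x \<Rightarrow> real) \<Rightarrow> bool" where
  "regfun g \<longleftrightarrow> g \<in> borel_measurable \<mu> \<and> (\<forall>x\<in>space \<mu>. \<bar>g x\<bar> \<le> M)"

lemma regfun_measurable: "regfun g \<Longrightarrow> g \<in> borel_measurable \<mu>"
  and regfun_bound: "regfun g \<Longrightarrow> x \<in> space \<mu> \<Longrightarrow> \<bar>g x\<bar> \<le> M"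
  by (auto simp: regfun_def)

lemma regfun_f0: "regfun f0"
  using f0_bound by (auto simp: regfun_def)

lemma regfun_sq_diff_le:
  assumes "regfun g" "regfun h" "x \<in> space \<mu>"
  shows "(g x - h x)^2 \<le> 4 * M^2"
proof -
  have "\<bar>g x - h x\<bar> \<le> 2 * M"
    using regfun_bound[OF assms(1,3)] regfun_bound[OF assms(2,3)] by linarith
  then have "\<bar>g x - h x\<bar>^2 \<le> (2 * M)^2" by (intro power_mono) auto
  then show ?thesis by (simp add: power2_eq_square)
qed

lemma integrable_sq_diff:
  assumes "regfun g" "regfun h"
  shows "integrable \<mu> (\<lambda>x. (g x - h x)^2)"
  using regfun_measurable[OF assms(1)] regfun_measurable[OF assms(2)] regfun_sq_diff_le[OF assms]
  by (intro integrable_const_bound[where B="4 * M^2"]) auto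

lemma L2_dist_sq: "(L2_dist \<mu> g h)^2 = (LINT x|\<mu>. (g x - h x)^2)"
  unfolding L2_dist_def by (intro real_sqrt_pow2 integral_nonneg_AE) auto

lemma L2_dist_nonneg: "L2_dist \<mu> g h \<ge> 0"
  unfolding L2_dist_def by (simp add: integral_nonneg_AE)

lemma L2_dist_commute: "L2_dist \<mu> g h = L2_dist \<mu> h g"
  by (simp add: L2_dist_def power2_commute)

text \<open>The squared form with factor 2 follows pointwise from \<open>(u - v)^2 \<ge> 0\<close>;
  the lost factor only enlarges constants and spares Minkowski's inequality.\<close>

lemma L2_dist_sq_triangle:
  assumes "regfun g" "regfun h" "regfun k"
  shows "(L2_dist \<mu> g k)^2 \<le> 2 * (L2_dist \<mu> g h)^2 + 2 * (L2_dist \<mu> h k)^2"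
proof -
  have pt: "(g x - k x)^2 \<le> 2 * (g x - h x)^2 + 2 * (h x - k x)^2" for x
    using zero_le_power2[of "(g x - h x) - (h x - k x)"]
    by (simp add: power2_eq_square algebra_simps)
  have "(LINT x|\<mu>. (g x - k x)^2) \<le> (LINT x|\<mu>. 2 * (g x - h x)^2 + 2 * (h x - k x)^2)"
    using assms by (intro integral_mono pt integrable_sq_diff Bochner_Integration.integrable_add
        integrable_mult_right) auto
  also have "\<dots> = 2 * (LINT x|\<mu>. (g x - h x)^2) + 2 * (LINT x|\<mu>. (h x - k x)^2)"
    using assms by (simp add: integrable_sq_diff)
  finally show ?thesis by (simp add: L2_dist_sq)
qed

lemma L2_dist_sq_le_sup:
  assumes "regfun g" "regfun h" "\<And>x. x \<in> space \<mu> \<Longrightarrow> \<bar>g x - h x\<bar> \<le> \<delta>"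
  shows "(L2_dist \<mu> g h)^2 \<le> \<delta>^2"
proof -
  have "(LINT x|\<mu>. (g x - h x)^2) \<le> (LINT x|\<mu>. \<delta>^2)"
  proof (rule integral_mono[OF integrable_sq_diff[OF assms(1,2)]])
    fix x assume "x \<in> space \<mu>"
    from power_mono[OF assms(3)[OF this], of 2] show "(g x - h x)^2 \<le> \<delta>^2" by simp
  qed auto
  then show ?thesis by (simp add: L2_dist_sq prob_space)
qed

text \<open>Arises from \<open>exp (- v) \<le> 1 / (1 + v)\<close> with \<open>v = u\<^sup>2 / (16 \<sigma>\<^sup>2)\<close> and \<open>u\<^sup>2 \<le> 4 M\<^sup>2\<close>.\<close>

definition \<rho> :: real where "\<rho> = 1 / (16 * \<sigma>^2 + 4 * M^2)"

lemma rho_pos: "\<rho> > 0"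
  using sigma_pos by (simp add: \<rho>_def add_pos_nonneg)

lemma exp_neg_sq_le:
  assumes "u^2 \<le> 4 * M^2"
  shows "exp (- (u^2) / (16 * \<sigma>^2)) \<le> 1 - \<rho> * u^2"
proof -
  let ?v = "u^2 / (16 * \<sigma>^2)"
  have s: "\<sigma>^2 > 0" using sigma_pos by simp
  have "exp (- ?v) = 1 / exp ?v" by (simp add: exp_minus field_simps)
  also have "\<dots> \<le> 1 / (1 + ?v)"
    using exp_ge_add_one_self[of ?v] s by (intro divide_left_mono) (auto intro!: mult_pos_pos add_pos_nonneg)
  also have "\<dots> = 1 - u^2 / (16 * \<sigma>^2 + u^2)"
  proof -
    have "16 * \<sigma>^2 + u^2 \<noteq> 0" using s zero_le_power2[of u] by linarith
    with s show ?thesis by (simp add: field_simps)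
  qed
  also have "u^2 / (16 * \<sigma>^2 + u^2) \<ge> u^2 / (16 * \<sigma>^2 + 4 * M^2)"
    using s assms by (intro divide_left_mono) (auto intro!: mult_pos_pos add_pos_nonneg)
  then have "1 - u^2 / (16 * \<sigma>^2 + u^2) \<le> 1 - \<rho> * u^2" by (simp add: \<rho>_def)
  finally show ?thesis by simp
qed

text \<open>The majorant linear in the square integrates to an expression in the L2 distance;
  \<open>1 - y \<le> exp (- y)\<close> then restores an exponential, whose powers are
  explicit.\<close>

lemma nn_integral_exp_neg_sq_le:
  assumes "regfun g"
  shows "(\<integral>\<^sup>+x. ennreal (exp (- ((g x - f0 x)^2) / (16 * \<sigma>^2))) \<partial>\<mu>)
    \<le> ennreal (exp (- \<rho> * (L2_dist \<mu> g f0)^2))"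
proof -
  note [measurable] = regfun_measurable[OF assms]
  have int: "integrable \<mu> (\<lambda>x. 1 - \<rho> * (g x - f0 x)^2)"
    using integrable_sq_diff[OF assms regfun_f0] by simp
  have pt: "exp (- ((g x - f0 x)^2) / (16 * \<sigma>^2)) \<le> 1 - \<rho> * (g x - f0 x)^2" if "x \<in> space \<mu>" for x
    using exp_neg_sq_le[OF regfun_sq_diff_le[OF assms regfun_f0 that]] .
  have "(\<integral>\<^sup>+x. ennreal (exp (- ((g x - f0 x)^2) / (16 * \<sigma>^2))) \<partial>\<mu>)
      \<le> (\<integral>\<^sup>+x. ennreal (1 - \<rho> * (g x - f0 x)^2) \<partial>\<mu>)"
    using pt by (intro nn_integral_mono ennreal_leI)
  also have "\<dots> = ennreal (LINT x|\<mu>. 1 - \<rho> * (g x - f0 x)^2)"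
    using pt by (intro nn_integral_eq_integral int AE_I2) (smt (verit) exp_ge_zero)
  also have "(LINT x|\<mu>. 1 - \<rho> * (g x - f0 x)^2) = 1 + - \<rho> * (L2_dist \<mu> g f0)^2"
    using integrable_sq_diff[OF assms regfun_f0] by (simp add: L2_dist_sq prob_space)
  also have "ennreal \<dots> \<le> ennreal (exp (- \<rho> * (L2_dist \<mu> g f0)^2))"
    by (intro ennreal_leI exp_ge_add_one_self)
  finally show ?thesis .
qed

section \<open>Moments of one likelihood ratio and errors of its test\<close>

lemma lik_ratio_measurable[measurable]:
  assumes [measurable]: "g \<in> borel_measurable \<mu>"
  shows "lik_ratio \<sigma> f0 g n \<in> borel_measurable (data_law \<mu> \<sigma> f0 n)"
proof -
  have "(\<lambda>z. exp (\<Sum>i<n. log_ratio \<sigma> f0 g (z i))) \<in> borel_measurable (data_law \<mu> \<sigma> f0 n)"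
    by measurable
  then show ?thesis
    using lik_ratio_eq_exp[OF sigma_pos, of f0 g n] by presburger
qed

lemma lik_ratio_pos: "lik_ratio \<sigma> f0 g n z > 0"
  by (simp add: lik_ratio_eq_exp[OF sigma_pos])

lemma lik_ratio_mean:
  assumes "regfun g"
  shows "(\<integral>\<^sup>+z. ennreal (lik_ratio \<sigma> f0 g n z) \<partial>data_law \<mu> \<sigma> f0 n) = 1"
  using nn_integral_exp_log_ratio[OF regfun_measurable[OF assms] regfun_measurable[OF assms],
    where a = 1 and b = 0 and n = n]
  by (simp add: lik_ratio_eq_exp[OF sigma_pos] emeasure_space_1)

text \<open>Chernoff bound with exponent 1/2: on the event the square root of the likelihood ratio
  exceeds 1, and its mean is the \<open>n\<close>-th power of a Hellinger affinity.\<close>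

lemma lik_ratio_exceeds_1_le:
  assumes g: "regfun g"
  shows "emeasure (data_law \<mu> \<sigma> f0 n) {z\<in>space (data_law \<mu> \<sigma> f0 n). lik_ratio \<sigma> f0 g n z > 1}
    \<le> ennreal (exp (- (real n * \<rho> * (L2_dist \<mu> g f0)^2)))"
proof -
  let ?P = "data_law \<mu> \<sigma> f0 n"
  note gm[measurable] = regfun_measurable[OF g]
  have "emeasure ?P {z\<in>space ?P. lik_ratio \<sigma> f0 g n z > 1}
      = (\<integral>\<^sup>+z. indicator {z\<in>space ?P. lik_ratio \<sigma> f0 g n z > 1} z \<partial>?P)"
    by (subst nn_integral_indicator) auto
  also have "\<dots> \<le> (\<integral>\<^sup>+z. ennreal (exp (1/2 * (\<Sum>i<n. log_ratio \<sigma> f0 g (z i))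
      + 0 * (\<Sum>i<n. log_ratio \<sigma> f0 g (z i)))) \<partial>?P)"
    by (intro nn_integral_mono) (auto simp: indicator_def lik_ratio_eq_exp[OF sigma_pos])
  also have "\<dots> = (\<integral>\<^sup>+x. ennreal (exp (((1/2 * (g x - f0 x) + 0 * (g x - f0 x))^2
        - 1/2 * (g x - f0 x)^2 - 0 * (g x - f0 x)^2) / (2 * \<sigma>^2))) \<partial>\<mu>) ^ n"
    by (rule nn_integral_exp_log_ratio[OF gm gm])
  also have "\<dots> \<le> (\<integral>\<^sup>+x. ennreal (exp (- ((g x - f0 x)^2) / (16 * \<sigma>^2))) \<partial>\<mu>) ^ n"
  proof (intro power_mono nn_integral_mono ennreal_leI)
    fix x
    \<comment> \<open>The exact coefficient is 1/8; it is weakened to 1/16 so that the same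
      \<open>\<rho>\<close> serves both kinds of error.\<close>
    have "((1/2 * u + 0 * u)^2 - 1/2 * u^2 - 0 * u^2) / (2 * \<sigma>^2) \<le> - (u^2) / (16 * \<sigma>^2)" for u :: real
      using sigma_pos by (simp add: field_simps power2_eq_square)
    then show "exp (((1/2 * (g x - f0 x) + 0 * (g x - f0 x))^2
        - 1/2 * (g x - f0 x)^2 - 0 * (g x - f0 x)^2) / (2 * \<sigma>^2)) \<le> exp (- ((g x - f0 x)^2) / (16 * \<sigma>^2))"
      by (simp only: exp_le_cancel_iff)
  qed auto
  also have "\<dots> \<le> ennreal (exp (- \<rho> * (L2_dist \<mu> g f0)^2)) ^ n"
    by (intro power_mono nn_integral_exp_neg_sq_le g) auto
  also have "\<dots> = ennreal (exp (- (real n * \<rho> * (L2_dist \<mu> g f0)^2)))"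
    by (simp add: ennreal_power exp_of_nat_mult[symmetric] mult_ac)
  finally show ?thesis .
qed

text \<open>The type II error of the test rejecting when \<open>lik_ratio g > 1\<close>, against every \<open>f\<close> near \<open>g\<close>:
  on acceptance \<open>lik f \<le> lik f / sqrt (lik g)\<close>, whose mean is explicit.\<close>

lemma lik_ratio_accepted_le:
  assumes f: "regfun f" and g: "regfun g"
    and close: "\<And>x. x \<in> space \<mu> \<Longrightarrow> \<bar>f x - g x\<bar> \<le> \<delta>"
  shows "(\<integral>\<^sup>+z. ennreal (lik_ratio \<sigma> f0 f n z) * indicator {z. lik_ratio \<sigma> f0 g n z \<le> 1} z \<partial>data_law \<mu> \<sigma> f0 n)
    \<le> ennreal (exp (real n * (\<delta>^2 / \<sigma>^2 - \<rho> * (L2_dist \<mu> g f0)^2)))"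
proof -
  let ?P = "data_law \<mu> \<sigma> f0 n"
  note fm[measurable] = regfun_measurable[OF f] and gm[measurable] = regfun_measurable[OF g]
  have "(\<integral>\<^sup>+z. ennreal (lik_ratio \<sigma> f0 f n z) * indicator {z. lik_ratio \<sigma> f0 g n z \<le> 1} z \<partial>?P)
     \<le> (\<integral>\<^sup>+z. ennreal (exp (1 * (\<Sum>i<n. log_ratio \<sigma> f0 f (z i))
      + (-1/2) * (\<Sum>i<n. log_ratio \<sigma> f0 g (z i)))) \<partial>?P)"
    by (intro nn_integral_mono) (auto simp: indicator_def lik_ratio_eq_exp[OF sigma_pos])
  also have "\<dots> = (\<integral>\<^sup>+x. ennreal (exp (((1 * (f x - f0 x) + (-1/2) * (g x - f0 x))^2
        - 1 * (f x - f0 x)^2 - (-1/2) * (g x - f0 x)^2) / (2 * \<sigma>^2))) \<partial>\<mu>) ^ n"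
    by (rule nn_integral_exp_log_ratio[OF fm gm])
  also have "\<dots> \<le> (\<integral>\<^sup>+x. ennreal (exp (\<delta>^2 / \<sigma>^2)) * ennreal (exp (- ((g x - f0 x)^2) / (16 * \<sigma>^2))) \<partial>\<mu>) ^ n"
  proof (intro power_mono nn_integral_mono)
    fix x assume x: "x \<in> space \<mu>"
    define u v w where "u = f x - f0 x" and "v = g x - f0 x" and "w = u - v"
    have "\<bar>w\<bar> \<le> \<delta>" using close[OF x] by (simp add: u_def v_def w_def)
    then have w: "w^2 \<le> \<delta>^2" by (metis abs_ge_zero power2_abs power_mono)
    \<comment> \<open>The cross term in \<open>w * v\<close> is absorbed into the square
      \<open>(4 * w + v)^2\<close>, which uses up half of the negative term in
      \<open>v^2\<close>.\<close>
    have "((1 * u + (-1/2) * v)^2 - 1 * u^2 - (-1/2) * v^2) / (2 * \<sigma>^2)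
        = w^2 / \<sigma>^2 + - (v^2) / (16 * \<sigma>^2) - (4 * w + v)^2 / (16 * \<sigma>^2)"
      using sigma_pos unfolding w_def by (simp add: field_simps power2_eq_square)
    also have "\<dots> \<le> \<delta>^2 / \<sigma>^2 + - (v^2) / (16 * \<sigma>^2)"
      using w sigma_pos by (smt (verit) divide_right_mono zero_le_power2 divide_nonneg_nonneg)
    finally show "ennreal (exp (((1 * (f x - f0 x) + (-1/2) * (g x - f0 x))^2
        - 1 * (f x - f0 x)^2 - (-1/2) * (g x - f0 x)^2) / (2 * \<sigma>^2)))
      \<le> ennreal (exp (\<delta>^2 / \<sigma>^2)) * ennreal (exp (- ((g x - f0 x)^2) / (16 * \<sigma>^2)))"
      unfolding u_def[symmetric] v_def[symmetric]
      by (simp only: ennreal_mult'[symmetric] exp_ge_zero exp_add[symmetric] exp_le_cancel_iff ennreal_leI)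
  qed auto
  also have "\<dots> \<le> (ennreal (exp (\<delta>^2 / \<sigma>^2)) * ennreal (exp (- \<rho> * (L2_dist \<mu> g f0)^2))) ^ n"
    by (subst nn_integral_cmult, measurable) (intro power_mono mult_left_mono nn_integral_exp_neg_sq_le g; simp)
  also have "\<dots> = ennreal (exp (real n * (\<delta>^2 / \<sigma>^2 - \<rho> * (L2_dist \<mu> g f0)^2)))"
    by (simp only: ennreal_mult'[symmetric] exp_ge_zero exp_add[symmetric] ennreal_power
        exp_of_nat_mult[symmetric]) simp
  finally show ?thesis .
qed

text \<open>Arises from \<open>exp t \<le> 1 + t exp t\<close> with \<open>t = (g x - f0 x)\<^sup>2 / \<sigma>\<^sup>2 \<le> 4 M\<^sup>2 / \<sigma>\<^sup>2\<close>.\<close>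

definition chi_const :: real where "chi_const = exp (4 * M^2 / \<sigma>^2) / \<sigma>^2"

lemma chi_const_pos: "chi_const > 0"
  using sigma_pos by (simp add: chi_const_def)

text \<open>For one observation the inverse ratio has mean 1 plus a chi-square divergence, here the
  average of \<open>exp (u^2 / \<sigma>^2)\<close> with \<open>u = g x - f0 x\<close>. This negative
  moment controls how small the evidence can become.\<close>

lemma inverse_lik_ratio_le:
  assumes g: "regfun g"
  shows "(\<integral>\<^sup>+z. ennreal (1 / lik_ratio \<sigma> f0 g n z) \<partial>data_law \<mu> \<sigma> f0 n)
    \<le> ennreal (exp (real n * chi_const * (L2_dist \<mu> g f0)^2))"
proof -
  let ?P = "data_law \<mu> \<sigma> f0 n"
  note gm[measurable] = regfun_measurable[OF g]
  have "(\<integral>\<^sup>+z. ennreal (1 / lik_ratio \<sigma> f0 g n z) \<partial>?P)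
     = (\<integral>\<^sup>+z. ennreal (exp ((-1) * (\<Sum>i<n. log_ratio \<sigma> f0 g (z i))
      + 0 * (\<Sum>i<n. log_ratio \<sigma> f0 g (z i)))) \<partial>?P)"
    by (simp add: lik_ratio_eq_exp[OF sigma_pos] exp_minus divide_inverse)
  also have "\<dots> = (\<integral>\<^sup>+x. ennreal (exp ((((-1) * (g x - f0 x) + 0 * (g x - f0 x))^2
        - (-1) * (g x - f0 x)^2 - 0 * (g x - f0 x)^2) / (2 * \<sigma>^2))) \<partial>\<mu>) ^ n"
    by (rule nn_integral_exp_log_ratio[OF gm gm])
  also have "\<dots> \<le> (\<integral>\<^sup>+x. ennreal (1 + chi_const * (g x - f0 x)^2) \<partial>\<mu>) ^ n"
  proof (intro power_mono nn_integral_mono ennreal_leI)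
    fix x assume x: "x \<in> space \<mu>"
    define t where "t = (g x - f0 x)^2 / \<sigma>^2"
    have t: "0 \<le> t" "t \<le> 4 * M^2 / \<sigma>^2"
      using regfun_sq_diff_le[OF g regfun_f0 x] by (auto simp: t_def intro: divide_right_mono)
    have "1 - t \<le> exp (- t)" using exp_ge_add_one_self[of "- t"] by simp
    then have "(1 - t) * exp t \<le> 1" by (simp add: exp_minus field_simps)
    then have "exp t \<le> 1 + t * exp t" by (simp add: algebra_simps)
    also have "\<dots> \<le> 1 + t * exp (4 * M^2 / \<sigma>^2)"
      using t by (auto intro!: mult_left_mono)
    also have "\<dots> = 1 + chi_const * (g x - f0 x)^2" by (simp add: t_def chi_const_def)
    finally have "exp t \<le> 1 + chi_const * (g x - f0 x)^2" .
    moreover have "(((-1) * u + 0 * u)^2 - (-1) * u^2 - 0 * u^2) / (2 * \<sigma>^2) = u^2 / \<sigma>^2" for u :: real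
      by simp
    ultimately show "exp ((((-1) * (g x - f0 x) + 0 * (g x - f0 x))^2
        - (-1) * (g x - f0 x)^2 - 0 * (g x - f0 x)^2) / (2 * \<sigma>^2)) \<le> 1 + chi_const * (g x - f0 x)^2"
      by (simp only: t_def)
  qed auto
  also have "(\<integral>\<^sup>+x. ennreal (1 + chi_const * (g x - f0 x)^2) \<partial>\<mu>)
      = ennreal (LINT x|\<mu>. 1 + chi_const * (g x - f0 x)^2)"
    using integrable_sq_diff[OF g regfun_f0] chi_const_pos
    by (intro nn_integral_eq_integral AE_I2) auto
  also have "(LINT x|\<mu>. 1 + chi_const * (g x - f0 x)^2) = 1 + chi_const * (L2_dist \<mu> g f0)^2"
    using integrable_sq_diff[OF g regfun_f0] by (simp add: L2_dist_sq prob_space)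
  also have "ennreal \<dots> ^ n \<le> ennreal (exp (chi_const * (L2_dist \<mu> g f0)^2)) ^ n"
    by (intro power_mono ennreal_leI exp_ge_add_one_self) auto
  also have "\<dots> = ennreal (exp (real n * chi_const * (L2_dist \<mu> g f0)^2))"
    by (simp add: ennreal_power exp_of_nat_mult[symmetric] mult_ac)
  finally show ?thesis .
qed

section \<open>Kullback-Leibler divergence between two regression densities\<close>

text \<open>For a fixed covariate the logarithm of the density ratio is a constant plus a multiple
  of the centred response, which integrates to zero. Most of the work secures integrability on the
  product space, so that Fubini's theorem gives the value.\<close>

lemma KL_div_reg_density:
  assumes g: "regfun g"
  shows "KL_div (\<mu> \<Otimes>\<^sub>M lborel) (reg_density \<sigma> f0) (reg_density \<sigma> g)
    = (L2_dist \<mu> f0 g)^2 / (2 * \<sigma>^2)"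
proof -
  note gm[measurable] = regfun_measurable[OF g]
  interpret pair_sigma_finite \<mu> lborel ..
  let ?K = "\<lambda>(x, y). normal_density (f0 x) \<sigma> y * (((f0 x - g x)^2 + 2 * (f0 x - g x) * (y - f0 x)) / (2 * \<sigma>^2))"
  \<comment> \<open>Dominating function for \<open>?K\<close>: with \<open>v = f0 x - g x\<close>
    and \<open>e = y - f0 x\<close>, the numerator \<open>v^2 + 2 * v * e\<close> is at most
    \<open>2 * v^2 + e^2\<close> in absolute value, and \<open>v^2 \<le> 4 * M^2\<close>.\<close>
  let ?B = "\<lambda>(x, y). normal_density (f0 x) \<sigma> y * ((8 * M^2 + (y - f0 x)^2) / (2 * \<sigma>^2))"
  have eq: "reg_density \<sigma> f0 w * ln (reg_density \<sigma> f0 w / reg_density \<sigma> g w) = ?K w" for w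
  proof -
    have "reg_density \<sigma> f0 w / reg_density \<sigma> g w = exp (- log_ratio \<sigma> f0 g w)"
      using reg_density_ratio[OF sigma_pos, of g w f0]
      by (metis exp_minus inverse_divide)
    then show ?thesis using sigma_pos
      by (cases w) (simp add: reg_density_def log_ratio_def field_simps power2_eq_square)
  qed
  have moments: "integrable lborel (\<lambda>y. normal_density \<mu>' \<sigma> y)"
    "integrable lborel (\<lambda>y. normal_density \<mu>' \<sigma> y * (y - \<mu>'))"
    "integrable lborel (\<lambda>y. normal_density \<mu>' \<sigma> y * (y - \<mu>')^2)"
    "(LINT y|lborel. normal_density \<mu>' \<sigma> y * (y - \<mu>')) = 0"
    "(LINT y|lborel. normal_density \<mu>' \<sigma> y * (y - \<mu>')^2) = \<sigma>^2" for \<mu>'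
    using sigma_pos integrable_normal_moment[of \<sigma> \<mu>' 1] integrable_normal_moment[of \<sigma> \<mu>' 2]
      integral_normal_moment_odd[of \<sigma> \<mu>' 0] integral_normal_moment_even[of \<sigma> \<mu>' 1]
    by (auto simp: numeral_2_eq_2 fact_numeral)
  have inner: "(\<integral>\<^sup>+y. ennreal (?B (x, y)) \<partial>lborel) = ennreal ((8 * M^2 + \<sigma>^2) / (2 * \<sigma>^2))" for x
  proof -
    have "?B (x, y) = (8 * M^2 / (2 * \<sigma>^2)) * normal_density (f0 x) \<sigma> y
        + (1 / (2 * \<sigma>^2)) * (normal_density (f0 x) \<sigma> y * (y - f0 x)^2)" for y
      by (simp add: add_divide_distrib algebra_simps)
    then have "integrable lborel (\<lambda>y. ?B (x, y))" "(LINT y|lborel. ?B (x, y)) = (8 * M^2 + \<sigma>^2) / (2 * \<sigma>^2)"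
      using moments[of "f0 x"] sigma_pos by (simp_all add: add_divide_distrib)
    then show ?thesis using sigma_pos by (subst nn_integral_eq_integral) auto
  qed
  have "(\<integral>\<^sup>+w. ennreal (?B w) \<partial>(\<mu> \<Otimes>\<^sub>M lborel)) = (\<integral>\<^sup>+x. \<integral>\<^sup>+y. ennreal (?B (x, y)) \<partial>lborel \<partial>\<mu>)"
    by (intro lborel.nn_integral_fst[symmetric]) (unfold normal_density_def, measurable)
  then have fin: "(\<integral>\<^sup>+w. ennreal (?B w) \<partial>(\<mu> \<Otimes>\<^sub>M lborel)) < \<infinity>"
    by (simp only: inner) (simp add: emeasure_space_1)
  have "integrable (\<mu> \<Otimes>\<^sub>M lborel) ?B"
  proof (rule integrableI_nonneg)
    show "?B \<in> borel_measurable (\<mu> \<Otimes>\<^sub>M lborel)"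
      unfolding normal_density_def by measurable
  qed (use fin in \<open>auto intro!: AE_I2\<close>)
  then have int: "integrable (\<mu> \<Otimes>\<^sub>M lborel) ?K"
  proof (rule Bochner_Integration.integrable_bound)
    show "?K \<in> borel_measurable (\<mu> \<Otimes>\<^sub>M lborel)"
      unfolding normal_density_def by measurable
    show "AE w in \<mu> \<Otimes>\<^sub>M lborel. norm (?K w) \<le> norm (?B w)"
    proof (rule AE_I2)
      fix w :: "'x \<times> real" assume "w \<in> space (\<mu> \<Otimes>\<^sub>M lborel)"
      then obtain x y where w: "w = (x, y)" "x \<in> space \<mu>" by (auto simp: space_pair_measure)
      define v e where "v = f0 x - g x" and "e = y - f0 x"
      have v: "v^2 \<le> 4 * M^2" using regfun_sq_diff_le[OF regfun_f0 g w(2)] by (simp add: v_def)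
      have sq: "2 * v * e \<le> v^2 + e^2" "- (2 * v * e) \<le> v^2 + e^2"
        using zero_le_power2[of "v - e"] zero_le_power2[of "v + e"]
        by (simp_all add: power2_eq_square algebra_simps)
      have "\<bar>v^2 + 2 * v * e\<bar> \<le> 8 * M^2 + e^2"
        using v sq zero_le_power2[of M] by linarith
      then have "\<bar>normal_density (f0 x) \<sigma> y * ((v^2 + 2 * v * e) / (2 * \<sigma>^2))\<bar>
          \<le> normal_density (f0 x) \<sigma> y * ((8 * M^2 + e^2) / (2 * \<sigma>^2))"
        by (simp add: abs_mult mult_left_mono divide_right_mono)
      then show "norm (?K w) \<le> norm (?B w)"
        by (simp add: w v_def e_def)
    qed
  qed
  have "KL_div (\<mu> \<Otimes>\<^sub>M lborel) (reg_density \<sigma> f0) (reg_density \<sigma> g) = (LINT w|(\<mu> \<Otimes>\<^sub>M lborel). ?K w)"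
    unfolding KL_div_def eq ..
  also have "\<dots> = (LINT x|\<mu>. LINT y|lborel. ?K (x, y))"
    by (rule integral_fst'[OF int, symmetric])
  also have "\<dots> = (LINT x|\<mu>. (f0 x - g x)^2 / (2 * \<sigma>^2))"
  proof (intro Bochner_Integration.integral_cong refl)
    fix x
    have "?K (x, y) = ((f0 x - g x)^2 / (2 * \<sigma>^2)) * normal_density (f0 x) \<sigma> y
        + (2 * (f0 x - g x) / (2 * \<sigma>^2)) * (normal_density (f0 x) \<sigma> y * (y - f0 x))" for y
      using sigma_pos by (simp add: field_simps)
    then show "(LINT y|lborel. ?K (x, y)) = (f0 x - g x)^2 / (2 * \<sigma>^2)"
      using moments[of "f0 x"] sigma_pos by simp
  qed
  finally show ?thesis by (simp add: L2_dist_sq)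
qed

section \<open>One test for a whole model, at all distances from the truth\<close>

text \<open>Each shell has at most \<open>N\<close> centres whatever its radius, while a test in
  shell \<open>k\<close> errs with probability at most \<open>x ^ (k + 1)\<close>, where
  \<open>x\<close> is the exponential in \<open>large\<close>. Since \<open>x \<le> 1 / 2\<close>,
  uniting the rejection regions of all shells costs only a factor 2.\<close>

lemma exists_test:
  fixes F :: "'p \<Rightarrow> 'x \<Rightarrow> real"
  assumes reg: "\<And>\<theta>. \<theta> \<in> T \<Longrightarrow> regfun (F \<theta>)"
    and s: "s > 0" and \<kappa>: "\<kappa> > 0" "\<kappa> \<le> 1 / 2" "8 * \<kappa>^2 \<le> \<rho> * \<sigma>^2" and N: "N \<ge> 0"
    and cover: "\<And>r \<theta>. r > 0 \<Longrightarrow> \<theta> \<in> T \<Longrightarrow> \<exists>S. finite S \<and> S \<subseteq> T \<and> real (card S) \<le> N \<and>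
        pball T (\<lambda>\<theta> \<eta>. L2_dist \<mu> (F \<theta>) (F \<eta>)) \<theta> (4 * r)
          \<subseteq> (\<Union>\<eta>\<in>S. pball T (\<lambda>\<theta> \<eta>. sup_dist \<mu> (F \<theta>) (F \<eta>)) \<eta> (\<kappa> * r))"
    and large: "exp (- (real n * \<rho> * s^2 / 4)) \<le> 1 / 2"
  shows "\<exists>R\<in>sets (data_law \<mu> \<sigma> f0 n).
    emeasure (data_law \<mu> \<sigma> f0 n) R \<le> ennreal (2 * N * exp (- (real n * \<rho> * s^2 / 4))) \<and>
    (\<forall>\<theta>\<in>T. L2_dist \<mu> (F \<theta>) f0 > s \<longrightarrow>
      (\<integral>\<^sup>+z. ennreal (lik_ratio \<sigma> f0 (F \<theta>) n z) * indicator (- R) z \<partial>data_law \<mu> \<sigma> f0 n)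
        \<le> ennreal (exp (- (real n * \<rho> * s^2 / 8))))"
proof -
  let ?P = "data_law \<mu> \<sigma> f0 n"
  define shell where "shell k = {\<theta>\<in>T. 2^k * s < L2_dist \<mu> (F \<theta>) f0 \<and> L2_dist \<mu> (F \<theta>) f0 \<le> 2 * (2^k * s)}" for k :: nat
  have "\<exists>S. finite S \<and> S \<subseteq> T \<and> real (card S) \<le> N \<and>
      (\<forall>\<theta>\<in>shell k. \<exists>\<eta>\<in>S. \<forall>x\<in>space \<mu>. \<bar>F \<eta> x - F \<theta> x\<bar> \<le> \<kappa> * (2^k * s))" for k
  proof (cases "shell k = {}")
    case True
    with N show ?thesis by (intro exI[of _ "{}"]) auto
  next
    case False
    \<comment> \<open>The centre of the covered ball has to be a parameter, and \<open>f0\<close>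
      need not belong to the model; a member of the shell takes its place. Two members are at most 4
      inner radii apart.\<close>
    then obtain \<theta>0 where t0: "\<theta>0 \<in> shell k" by auto
    then have t0T: "\<theta>0 \<in> T" by (simp add: shell_def)
    let ?r = "2^k * s"
    have r: "?r > 0" using s by simp
    obtain S where S: "finite S" "S \<subseteq> T" "real (card S) \<le> N"
      "pball T (\<lambda>\<theta> \<eta>. L2_dist \<mu> (F \<theta>) (F \<eta>)) \<theta>0 (4 * ?r)
          \<subseteq> (\<Union>\<eta>\<in>S. pball T (\<lambda>\<theta> \<eta>. sup_dist \<mu> (F \<theta>) (F \<eta>)) \<eta> (\<kappa> * ?r))"
      using cover[OF r t0T] by blast
    have "\<exists>\<eta>\<in>S. \<forall>x\<in>space \<mu>. \<bar>F \<eta> x - F \<theta> x\<bar> \<le> \<kappa> * ?r" if th: "\<theta> \<in> shell k" for \<theta>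
    proof -
      have thT: "\<theta> \<in> T" using th by (simp add: shell_def)
      have "(L2_dist \<mu> (F \<theta>0) (F \<theta>))^2 \<le> 2 * (L2_dist \<mu> (F \<theta>0) f0)^2 + 2 * (L2_dist \<mu> (F \<theta>) f0)^2"
        using L2_dist_sq_triangle[OF reg[OF t0T] regfun_f0 reg[OF thT]]
        by (simp add: L2_dist_commute[of f0])
      also have "\<dots> \<le> 2 * (2 * ?r)^2 + 2 * (2 * ?r)^2"
        using t0 th L2_dist_nonneg by (intro add_mono mult_left_mono power_mono) (auto simp: shell_def)
      also have "\<dots> = (4 * ?r)^2" by (simp add: power2_eq_square)
      finally have "L2_dist \<mu> (F \<theta>0) (F \<theta>) \<le> 4 * ?r"
        using r by (auto intro: power2_le_imp_le)
      with thT S(4) obtain \<eta> where "\<eta> \<in> S"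
        "\<theta> \<in> pball T (\<lambda>\<theta> \<eta>. sup_dist \<mu> (F \<theta>) (F \<eta>)) \<eta> (\<kappa> * ?r)"
        by (auto simp: pball_def)
      with S(2) regfun_bound[OF reg] show ?thesis
        by (intro bexI[of _ \<eta>] ballI pball_sup_distD[where T = T and M = M]) auto
    qed
    with S show ?thesis by blast
  qed
  then obtain S where S: "finite (S k)" "S k \<subseteq> T" "real (card (S k)) \<le> N"
      "\<And>\<theta>. \<theta> \<in> shell k \<Longrightarrow> \<exists>\<eta>\<in>S k. \<forall>x\<in>space \<mu>. \<bar>F \<eta> x - F \<theta> x\<bar> \<le> \<kappa> * (2^k * s)" for k
    by metis
  define S' where "S' k = {\<eta>\<in>S k. (2^k * s)^2 / 4 \<le> (L2_dist \<mu> (F \<eta>) f0)^2}" for k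
  have S': "finite (S' k)" "S' k \<subseteq> T" "real (card (S' k)) \<le> N" for k
  proof -
    have "card (S' k) \<le> card (S k)" using S(1) by (intro card_mono) (auto simp: S'_def)
    with S(3)[of k] show "real (card (S' k)) \<le> N" by linarith
  qed (use S(1,2) in \<open>auto simp: S'_def\<close>)
  \<comment> \<open>Linear growth of the squared radii is enough to make the errors geometric in
    \<open>k\<close>.\<close>
  have power4: "(2^k * s)^2 \<ge> (real k + 1) * s^2" for k :: nat
  proof -
    have "real k + 1 \<le> 4 ^ k" by (induction k) auto
    then show ?thesis by (simp add: power_mult_distrib power_even_eq[symmetric] power_mult[symmetric] mult.commute[of k] mult_right_mono)
       (simp add: power_mult mult_right_mono)
  qed
  define E where "E \<eta> = {z\<in>space ?P. lik_ratio \<sigma> f0 (F \<eta>) n z > 1}" for \<eta>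
  have [measurable]: "F \<eta> \<in> borel_measurable \<mu>" if "\<eta> \<in> T" for \<eta>
    using regfun_measurable[OF reg[OF that]] .
  have E_sets: "E \<eta> \<in> sets ?P" if "\<eta> \<in> T" for \<eta>
    using that unfolding E_def by measurable
  define R where "R = (\<Union>k. \<Union>\<eta>\<in>S' k. E \<eta>)"
  have Rk_sets: "(\<Union>\<eta>\<in>S' k. E \<eta>) \<in> sets ?P" for k
    using S'[of k] E_sets by (intro sets.finite_UN) auto
  then have R_sets: "R \<in> sets ?P" unfolding R_def by (intro sets.countable_UN) auto
  define x where "x = exp (- (real n * \<rho> * s^2 / 4))"
  have x: "0 < x" "x \<le> 1 / 2" using large by (auto simp: x_def)
  have Rk: "emeasure ?P (\<Union>\<eta>\<in>S' k. E \<eta>) \<le> ennreal (N * x * (1/2)^k)" for k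
  proof -
    have "emeasure ?P (\<Union>\<eta>\<in>S' k. E \<eta>) \<le> (\<Sum>\<eta>\<in>S' k. emeasure ?P (E \<eta>))"
      using S'[of k] E_sets by (intro emeasure_subadditive_finite) auto
    also have "\<dots> \<le> (\<Sum>\<eta>\<in>S' k. ennreal (x ^ (k + 1)))"
    proof (rule sum_mono)
      fix \<eta> assume e: "\<eta> \<in> S' k"
      then have eT: "\<eta> \<in> T" using S'(2) by auto
      have "emeasure ?P (E \<eta>) \<le> ennreal (exp (- (real n * \<rho> * (L2_dist \<mu> (F \<eta>) f0)^2)))"
        unfolding E_def by (rule lik_ratio_exceeds_1_le[OF reg[OF eT]])
      also have "\<dots> \<le> ennreal (x ^ (k + 1))"
      proof (rule ennreal_leI)
        have "(real k + 1) * s^2 / 4 \<le> (L2_dist \<mu> (F \<eta>) f0)^2"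
          using e power4[of k] by (auto simp: S'_def)
        then have "real n * \<rho> * ((real k + 1) * s^2 / 4) \<le> real n * \<rho> * (L2_dist \<mu> (F \<eta>) f0)^2"
          using rho_pos by (intro mult_left_mono) auto
        then have "exp (- (real n * \<rho> * (L2_dist \<mu> (F \<eta>) f0)^2)) \<le> exp (real (k + 1) * (- (real n * \<rho> * s^2 / 4)))"
          by (simp add: algebra_simps)
        then show "exp (- (real n * \<rho> * (L2_dist \<mu> (F \<eta>) f0)^2)) \<le> x ^ (k + 1)"
          unfolding x_def exp_of_nat_mult .
      qed
      finally show "emeasure ?P (E \<eta>) \<le> ennreal (x ^ (k + 1))" .
    qed
    also have "\<dots> = ennreal (real (card (S' k)) * x ^ (k + 1))"
      using x by (simp add: ennreal_mult ennreal_of_nat_eq_real_of_nat)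
    also have "\<dots> \<le> ennreal (N * x * (1/2)^k)"
    proof (rule ennreal_leI)
      have "real (card (S' k)) * (x * x ^ k) \<le> N * (x * (1/2)^k)"
        using S'(3)[of k] N x by (intro mult_mono power_mono) auto
      then show "real (card (S' k)) * x ^ (k + 1) \<le> N * x * (1/2)^k" by (simp add: mult.assoc)
    qed
    finally show ?thesis .
  qed
  have "emeasure ?P R \<le> (\<Sum>k. emeasure ?P (\<Union>\<eta>\<in>S' k. E \<eta>))"
    unfolding R_def using Rk_sets by (intro emeasure_subadditive_countably) auto
  also have "\<dots> \<le> (\<Sum>k. ennreal (N * x * (1/2)^k))"
    by (intro suminf_le Rk) auto
  also have "\<dots> = ennreal (2 * N * x)"
    using sums_mult[OF geometric_sums[of "1/2::real"], of "N * x"] x N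
    by (intro suminf_ennreal_eq) (auto simp: mult_ac)
  finally have R_small: "emeasure ?P R \<le> ennreal (2 * N * x)" .
  have accept: "(\<integral>\<^sup>+z. ennreal (lik_ratio \<sigma> f0 (F \<theta>) n z) * indicator (- R) z \<partial>?P)
        \<le> ennreal (exp (- (real n * \<rho> * s^2 / 8)))"
    if th: "\<theta> \<in> T" "L2_dist \<mu> (F \<theta>) f0 > s" for \<theta>
  proof -
    define D where "D = L2_dist \<mu> (F \<theta>) f0"
    have "\<exists>k. D \<le> 2 * (2^k * s)"
    proof -
      obtain k where "D / s < 2 ^ k" using real_arch_pow[of 2 "D / s"] by auto
      with s have "D < 2^k * s" by (simp add: field_simps)
      moreover have "0 < 2^k * s" using s by simp
      ultimately show ?thesis by (intro exI[of _ k]) linarith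
    qed
    \<comment> \<open>The least such \<open>k\<close> selects the shell; the lower boundary comes
      from minimality, or from \<open>D > s\<close> when \<open>k = 0\<close>.\<close>
    then obtain k where k: "D \<le> 2 * (2^k * s)" "\<And>i. i < k \<Longrightarrow> \<not> D \<le> 2 * (2^i * s)"
      using exists_least_iff[of "\<lambda>k. D \<le> 2 * (2^k * s)"] by blast
    define r where "r = 2^k * s"
    have "r < D"
    proof (cases k)
      case 0 with th show ?thesis by (simp add: r_def D_def)
    next
      case (Suc i) with k(2)[of i] show ?thesis by (simp add: r_def)
    qed
    with k(1) th(1) have "\<theta> \<in> shell k" by (simp add: shell_def r_def D_def)
    from S(4)[OF this] obtain \<eta> where \<eta>: "\<eta> \<in> S k" "\<And>x. x\<in>space \<mu> \<Longrightarrow> \<bar>F \<eta> x - F \<theta> x\<bar> \<le> \<kappa> * r"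
      by (auto simp: r_def)
    have eT: "\<eta> \<in> T" using \<eta>(1) S(2) by auto
    have r: "r > 0" "r^2 \<ge> s^2"
    proof -
      show "r > 0" using s by (simp add: r_def)
      have "(real k + 1) * s^2 \<ge> 1 * s^2" by (intro mult_right_mono) auto
      then show "r^2 \<ge> s^2" using power4[of k] by (simp add: r_def)
    qed
    \<comment> \<open>With \<open>\<kappa> \<le> 1 / 2\<close> the approximation error takes at most
      half of \<open>r^2\<close>, which leaves \<open>r^2 / 4\<close> for the squared distance of
      the centre.\<close>
    have "r^2 \<le> D^2" using r \<open>r < D\<close> by (intro power_mono) auto
    also have "D^2 \<le> 2 * (L2_dist \<mu> (F \<theta>) (F \<eta>))^2 + 2 * (L2_dist \<mu> (F \<eta>) f0)^2"
      unfolding D_def by (rule L2_dist_sq_triangle[OF reg[OF th(1)] reg[OF eT] regfun_f0])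
    also have "(L2_dist \<mu> (F \<theta>) (F \<eta>))^2 \<le> (\<kappa> * r)^2"
      using \<eta>(2) by (intro L2_dist_sq_le_sup reg th(1) eT) (simp add: abs_minus_commute)
    also have "(\<kappa> * r)^2 \<le> (1/2 * r)^2"
      using \<kappa> r by (intro power_mono mult_right_mono) auto
    finally have far: "r^2 / 4 \<le> (L2_dist \<mu> (F \<eta>) f0)^2"
      by (simp add: power2_eq_square)
    then have "\<eta> \<in> S' k" using \<eta>(1) by (simp add: S'_def r_def)
    then have ER: "E \<eta> \<subseteq> R" by (auto simp: R_def)
    have "(\<integral>\<^sup>+z. ennreal (lik_ratio \<sigma> f0 (F \<theta>) n z) * indicator (- R) z \<partial>?P)
        \<le> (\<integral>\<^sup>+z. ennreal (lik_ratio \<sigma> f0 (F \<theta>) n z) * indicator {z. lik_ratio \<sigma> f0 (F \<eta>) n z \<le> 1} z \<partial>?P)"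
      using ER by (intro nn_integral_mono) (auto simp: E_def indicator_def)
    also have "\<dots> \<le> ennreal (exp (real n * ((\<kappa> * r)^2 / \<sigma>^2 - \<rho> * (L2_dist \<mu> (F \<eta>) f0)^2)))"
      using \<eta>(2) by (intro lik_ratio_accepted_le reg th(1) eT) (simp add: abs_minus_commute)
    also have "\<dots> \<le> ennreal (exp (- (real n * \<rho> * s^2 / 8)))"
    proof (rule ennreal_leI)
      \<comment> \<open>The test gains \<open>\<rho> * r^2 / 4\<close> in the exponent; the upper
        bound on \<open>\<kappa>^2\<close> limits the loss from the ball radius to half of
        that.\<close>
      have "(\<kappa> * r)^2 / \<sigma>^2 \<le> \<rho> / 8 * r^2"
      proof -
        have "8 * \<kappa>^2 * r^2 \<le> \<rho> * \<sigma>^2 * r^2" using \<kappa>(3) by (intro mult_right_mono) auto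
        then show ?thesis using sigma_pos by (simp add: power_mult_distrib field_simps)
      qed
      moreover have "\<rho> * (r^2 / 4) \<le> \<rho> * (L2_dist \<mu> (F \<eta>) f0)^2"
        using far rho_pos by (intro mult_left_mono) auto
      moreover have "\<rho> * s^2 \<le> \<rho> * r^2" using r rho_pos by (intro mult_left_mono) auto
      ultimately have "(\<kappa> * r)^2 / \<sigma>^2 - \<rho> * (L2_dist \<mu> (F \<eta>) f0)^2 \<le> - (\<rho> * s^2 / 8)" by linarith
      from mult_left_mono[OF this, of "real n"]
      show "exp (real n * ((\<kappa> * r)^2 / \<sigma>^2 - \<rho> * (L2_dist \<mu> (F \<eta>) f0)^2)) \<le> exp (- (real n * \<rho> * s^2 / 8))"
        by (simp add: mult.assoc)
    qed
    finally show ?thesis .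
  qed
  show ?thesis
    using R_sets R_small[unfolded x_def] accept by blast
qed

section \<open>Lower bound for the evidence\<close>

text \<open>Needed to exchange the integral over the prior with the mean over the data.\<close>

lemma lik_ratio_joint_measurable:
  assumes F[measurable]: "(\<lambda>(\<theta>, x). F \<theta> x) \<in> borel_measurable (\<pi> \<Otimes>\<^sub>M \<mu>)"
  shows "(\<lambda>(\<theta>, z). lik_ratio \<sigma> f0 (F \<theta>) n z) \<in> borel_measurable (\<pi> \<Otimes>\<^sub>M data_law \<mu> \<sigma> f0 n)"
proof -
  have "(\<lambda>(\<theta>, z). exp (\<Sum>i<n. log_ratio \<sigma> f0 (F \<theta>) (z i)))
      \<in> borel_measurable (\<pi> \<Otimes>\<^sub>M data_law \<mu> \<sigma> f0 n)"
  proof -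
    have [measurable]: "(\<lambda>(\<theta>, z). F \<theta> (fst (z i))) \<in> borel_measurable (\<pi> \<Otimes>\<^sub>M data_law \<mu> \<sigma> f0 n)" if "i \<in> {..<n}" for i
    proof -
      have "(\<lambda>(\<theta>, z). (\<theta>, fst (z i))) \<in> \<pi> \<Otimes>\<^sub>M data_law \<mu> \<sigma> f0 n \<rightarrow>\<^sub>M \<pi> \<Otimes>\<^sub>M \<mu>"
        using that by measurable
      from measurable_compose[OF this F] show ?thesis by (simp add: case_prod_beta')
    qed
    show ?thesis unfolding log_ratio_def by measurable
  qed
  then show ?thesis
    by (simp add: lik_ratio_eq_exp[OF sigma_pos])
qed

text \<open>The inequality \<open>2 t \<le> lik + t\<^sup>2 / lik\<close>, integrated over \<open>B\<close>, reduces the lower bound to Markov's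
  inequality for the integral of \<open>1 / lik\<close>.\<close>

lemma evidence_lower_bound:
  fixes F :: "'p \<Rightarrow> 'x \<Rightarrow> real"
  assumes prior: "prob_space \<pi>"
    and F: "(\<lambda>(\<theta>, x). F \<theta> x) \<in> borel_measurable (\<pi> \<Otimes>\<^sub>M \<mu>)"
    and B[measurable]: "B \<in> sets \<pi>" and B_pos: "measure \<pi> B > 0"
    and reg: "\<And>\<theta>. \<theta> \<in> B \<Longrightarrow> regfun (F \<theta>)"
    and near: "\<And>\<theta>. \<theta> \<in> B \<Longrightarrow> (L2_dist \<mu> (F \<theta>) f0)^2 \<le> c"
    and t: "t = exp (- (real n * chi_const * c + \<tau>))"
  obtains R where "R \<in> sets (data_law \<mu> \<sigma> f0 n)" "emeasure (data_law \<mu> \<sigma> f0 n) R \<le> ennreal (exp (- \<tau>))"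
    "\<And>z. z \<in> space (data_law \<mu> \<sigma> f0 n) \<Longrightarrow> z \<notin> R \<Longrightarrow>
       ennreal (t * measure \<pi> B) \<le> (\<integral>\<^sup>+\<theta>. ennreal (lik_ratio \<sigma> f0 (F \<theta>) n z) * indicator B \<theta> \<partial>\<pi>)"
proof -
  let ?P = "data_law \<mu> \<sigma> f0 n" and ?L = "\<lambda>\<theta> z. lik_ratio \<sigma> f0 (F \<theta>) n z"
  interpret prior: prob_space \<pi> by (rule prior)
  interpret data: prob_space ?P by (rule prob_space_data)
  interpret pair_prob_space \<pi> ?P ..
  note joint[measurable] = lik_ratio_joint_measurable[OF F, of n]
  have joint'[measurable]: "(\<lambda>(z, \<theta>). ?L \<theta> z) \<in> borel_measurable (?P \<Otimes>\<^sub>M \<pi>)"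
    using measurable_pair_swap[OF joint] by simp
  define U where "U z = (\<integral>\<^sup>+\<theta>. ennreal (1 / ?L \<theta> z) * indicator B \<theta> \<partial>\<pi>)" for z
  have [measurable]: "U \<in> borel_measurable ?P"
    unfolding U_def by measurable
  define p where "p = measure \<pi> B"
  have p: "p > 0" "emeasure \<pi> B = ennreal p" using B_pos by (simp_all add: p_def prior.emeasure_eq_measure)
  have t_pos: "t > 0" using t by simp
  \<comment> \<open>\<open>U z / p\<close> is the average of the inverse likelihood ratio under the
    prior conditioned on \<open>B\<close>; the exceptional event is that this average is at least
    \<open>1 / t\<close>.\<close>
  define R where "R = {z\<in>space ?P. 1 \<le> ennreal (t / p) * U z}"
  have "(\<integral>\<^sup>+z. U z \<partial>?P) = (\<integral>\<^sup>+\<theta>. \<integral>\<^sup>+z. ennreal (1 / ?L \<theta> z) * indicator B \<theta> \<partial>?P \<partial>\<pi>)"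
    unfolding U_def by (subst Fubini') auto
  also have "\<dots> \<le> (\<integral>\<^sup>+\<theta>. ennreal (exp (real n * chi_const * c)) * indicator B \<theta> \<partial>\<pi>)"
  proof (rule nn_integral_mono)
    fix \<theta>
    show "(\<integral>\<^sup>+z. ennreal (1 / ?L \<theta> z) * indicator B \<theta> \<partial>?P) \<le> ennreal (exp (real n * chi_const * c)) * indicator B \<theta>"
    proof (cases "\<theta> \<in> B")
      case True
      have "(\<integral>\<^sup>+z. ennreal (1 / ?L \<theta> z) \<partial>?P) \<le> ennreal (exp (real n * chi_const * (L2_dist \<mu> (F \<theta>) f0)^2))"
        by (rule inverse_lik_ratio_le[OF reg[OF True]])
      also have "\<dots> \<le> ennreal (exp (real n * chi_const * c))"
        using near[OF True] chi_const_pos by (intro ennreal_leI) (auto intro!: mult_left_mono)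
      finally show ?thesis using True by simp
    qed simp
  qed
  also have "\<dots> = ennreal (exp (real n * chi_const * c)) * ennreal p"
    by (simp add: nn_integral_cmult_indicator p)
  finally have EU: "(\<integral>\<^sup>+z. U z \<partial>?P) \<le> ennreal (exp (real n * chi_const * c) * p)"
    using p by (simp add: ennreal_mult)
  have "emeasure ?P R \<le> ennreal (t / p) * (\<integral>\<^sup>+z. U z * indicator (space ?P) z \<partial>?P)"
    unfolding R_def by (rule nn_integral_Markov_inequality) auto
  also have "(\<integral>\<^sup>+z. U z * indicator (space ?P) z \<partial>?P) = (\<integral>\<^sup>+z. U z \<partial>?P)"
    by (intro nn_integral_cong) simp
  also have "ennreal (t / p) * \<dots> \<le> ennreal (t / p) * ennreal (exp (real n * chi_const * c) * p)"
    by (intro mult_left_mono EU) auto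
  also have "\<dots> = ennreal (exp (- \<tau>))"
    using p t_pos unfolding t by (simp add: ennreal_mult'[symmetric] exp_add[symmetric])
  finally have R_small: "emeasure ?P R \<le> ennreal (exp (- \<tau>))" .
  have R_sets: "R \<in> sets ?P" unfolding R_def by measurable
  have "ennreal (t * p) \<le> (\<integral>\<^sup>+\<theta>. ennreal (?L \<theta> z) * indicator B \<theta> \<partial>\<pi>)" (is "_ \<le> ?X")
    if z: "z \<in> space ?P" "z \<notin> R" for z
  proof -
    have [measurable]: "(\<lambda>\<theta>. ?L \<theta> z) \<in> borel_measurable \<pi>"
      using measurable_Pair1[OF joint z(1)] by simp
    have "ennreal (t / p) * U z \<le> 1" using z by (simp add: R_def not_le less_imp_le)
    then have "ennreal (t * p) * (ennreal (t / p) * U z) \<le> ennreal (t * p) * 1"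
      by (intro mult_left_mono) auto
    then have tU: "ennreal (t^2) * U z \<le> ennreal (t * p)"
      using p t_pos by (simp add: mult.assoc[symmetric] ennreal_mult'[symmetric] power2_eq_square)
    have "ennreal (2 * t * p) = (\<integral>\<^sup>+\<theta>. ennreal (2 * t) * indicator B \<theta> \<partial>\<pi>)"
      using t_pos p by (simp add: nn_integral_cmult_indicator ennreal_mult)
    also have "\<dots> \<le> (\<integral>\<^sup>+\<theta>. ennreal (?L \<theta> z) * indicator B \<theta>
        + ennreal (t^2) * (ennreal (1 / ?L \<theta> z) * indicator B \<theta>) \<partial>\<pi>)"
    proof (rule nn_integral_mono)
      fix \<theta>
      have l: "?L \<theta> z > 0" by (rule lik_ratio_pos)
      have "2 * t * ?L \<theta> z \<le> (?L \<theta> z)^2 + t^2"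
        using zero_le_power2[of "?L \<theta> z - t"] by (simp add: power2_eq_square algebra_simps)
      then have "2 * t \<le> ?L \<theta> z + t^2 * (1 / ?L \<theta> z)"
        using l by (simp add: field_simps power2_eq_square)
      then have "ennreal (2 * t) \<le> ennreal (?L \<theta> z) + ennreal (t^2) * ennreal (1 / ?L \<theta> z)"
        using l by (simp add: ennreal_mult'[symmetric] ennreal_plus[symmetric] ennreal_leI del: ennreal_plus)
      then show "ennreal (2 * t) * indicator B \<theta> \<le> ennreal (?L \<theta> z) * indicator B \<theta>
        + ennreal (t^2) * (ennreal (1 / ?L \<theta> z) * indicator B \<theta>)"
        by (auto simp: indicator_def)
    qed
    also have "\<dots> = ?X + ennreal (t^2) * U z"
      unfolding U_def by (simp add: nn_integral_add nn_integral_cmult)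
    also have "\<dots> \<le> ?X + ennreal (t * p)" by (intro add_left_mono tU)
    finally have le: "ennreal (2 * t * p) \<le> ?X + ennreal (t * p)" .
    \<comment> \<open>Cancelling \<open>t * p\<close> on both sides is done in the reals, hence the
      case distinction on finiteness of \<open>?X\<close>.\<close>
    show "ennreal (t * p) \<le> ?X"
    proof (cases ?X)
      case (real X)
      have "ennreal (2 * t * p) \<le> ennreal (X + t * p)"
        using le real p t_pos by (simp add: ennreal_plus[symmetric] del: ennreal_plus)
      then have "t * p \<le> X"
        using real p t_pos by (subst (asm) ennreal_le_iff) (auto simp: mult.commute)
      with real show ?thesis by (simp add: ennreal_leI)
    qed simp
  qed
  with R_sets R_small that show ?thesis unfolding p_def by blast
qed

section \<open>Posterior probability at a fixed sample size\<close>

text \<open>Dropping the square that involves \<open>g\<close> leaves a bound depending on the data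
  alone, which serves all models and all parameters at once.\<close>

lemma lik_ratio_le:
  "lik_ratio \<sigma> f0 g n z \<le> exp (\<Sum>i<n. (snd (z i) - f0 (fst (z i)))^2 / (2 * \<sigma>^2))"
  unfolding lik_ratio_eq_exp[OF sigma_pos] log_ratio_def
  by (auto intro!: sum_mono divide_right_mono)

lemma L2_dist_measurable:
  assumes F[measurable]: "(\<lambda>(\<theta>, x). F \<theta> x) \<in> borel_measurable (\<pi> \<Otimes>\<^sub>M \<mu>)"
  shows "(\<lambda>\<theta>. L2_dist \<mu> (F \<theta>) f0) \<in> borel_measurable \<pi>"
  unfolding L2_dist_def by measurable

text \<open>The event in the conclusion need not be measurable; monotonicity of \<open>measure\<close> only needs
  measurability of the larger set, because non-measurable sets have measure \<open>0\<close>.\<close>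

lemma posterior_far_prob_le:
  fixes F :: "'j \<Rightarrow> 'p \<Rightarrow> 'x \<Rightarrow> real"
  assumes J: "countable J"
    and prior: "\<And>j. j \<in> J \<Longrightarrow> prob_space (prior j)"
    and F: "\<And>j. j \<in> J \<Longrightarrow> (\<lambda>(\<theta>, x). F j \<theta> x) \<in> borel_measurable (prior j \<Otimes>\<^sub>M \<mu>)"
    and a: "\<And>j. j \<in> J \<Longrightarrow> a j \<ge> 0" "a summable_on J"
    and R[measurable]: "R \<in> sets (data_law \<mu> \<sigma> f0 n)"
    and w: "\<And>j \<theta>. j \<in> J \<Longrightarrow> \<theta> \<in> space (prior j) \<Longrightarrow> L2_dist \<mu> (F j \<theta>) f0 > s \<Longrightarrow>
      (\<integral>\<^sup>+z. ennreal (lik_ratio \<sigma> f0 (F j \<theta>) n z) * indicator (- R) z \<partial>data_law \<mu> \<sigma> f0 n) \<le> ennreal (w j)"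
    and w_nonneg: "\<And>j. j \<in> J \<Longrightarrow> w j \<ge> 0"
    and v: "\<And>j. j \<in> J \<Longrightarrow> a j * w j \<le> v j" "(v has_sum V) J"
    and j0: "j0 \<in> J" "a j0 > 0"
    and R'[measurable]: "R' \<in> sets (data_law \<mu> \<sigma> f0 n)"
    and b: "b > 0" and B: "B \<subseteq> space (prior j0)"
    and evidence: "\<And>z. z \<in> space (data_law \<mu> \<sigma> f0 n) \<Longrightarrow> z \<notin> R' \<Longrightarrow>
      ennreal b \<le> (\<integral>\<^sup>+\<theta>. ennreal (lik_ratio \<sigma> f0 (F j0 \<theta>) n z) * indicator B \<theta> \<partial>prior j0)"
    and \<kappa>: "\<kappa> > 0"
  shows "measure (data_law \<mu> \<sigma> f0 n)
      {z\<in>space (data_law \<mu> \<sigma> f0 n). posterior_far \<mu> \<sigma> f0 J a prior F s n z > \<kappa>}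
    \<le> measure (data_law \<mu> \<sigma> f0 n) R + measure (data_law \<mu> \<sigma> f0 n) R' + V / (\<kappa> * a j0 * b)"
proof -
  let ?P = "data_law \<mu> \<sigma> f0 n" and ?L = "\<lambda>j \<theta> z. lik_ratio \<sigma> f0 (F j \<theta>) n z"
  interpret data: prob_space ?P by (rule prob_space_data)
  define far where "far j = {\<theta>\<in>space (prior j). L2_dist \<mu> (F j \<theta>) f0 > s}" for j
  have far_sets[measurable]: "far j \<in> sets (prior j)" if "j \<in> J" for j
    using L2_dist_measurable[OF F[OF that]] unfolding far_def by measurable
  have joint: "(\<lambda>(z, \<theta>). ?L j \<theta> z) \<in> borel_measurable (?P \<Otimes>\<^sub>M prior j)" if "j \<in> J" for j
    using measurable_pair_swap[OF lik_ratio_joint_measurable[OF F[OF that]]] by simp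
  define I where "I j z = (\<integral>\<^sup>+\<theta>. ennreal (?L j \<theta> z) * indicator (far j) \<theta> \<partial>prior j)" for j z
  have I_measurable: "I j \<in> borel_measurable ?P" if j: "j \<in> J" for j
  proof -
    interpret prior: prob_space "prior j" by (rule prior[OF j])
    note [measurable] = joint[OF j] far_sets[OF j]
    show ?thesis unfolding I_def by measurable
  qed
  have aI_measurable: "(\<lambda>z. ennreal (a j) * I j z) \<in> borel_measurable ?P" if "j \<in> J" for j
    using I_measurable[OF that] by measurable
  \<comment> \<open>The complement is taken in the whole type, so measurability is checked on its
    trace in the sample space.\<close>
  have [measurable]: "(indicator (- R) :: _ \<Rightarrow> ennreal) \<in> borel_measurable ?P"
  proof -
    have "- R \<inter> space ?P = space ?P - R" by blast
    then show ?thesis by (simp add: borel_measurable_indicator_iff)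
  qed
  \<comment> \<open>The numerator as an extended nonnegative integral over the counting measure: in
    this form it is measurable and can be averaged model by model. It is matched with the real
    numerator only pointwise, in \<open>num_z\<close>.\<close>
  define num where "num z = (\<integral>\<^sup>+j. ennreal (a j) * I j z \<partial>count_space J)" for z
  have num_measurable[measurable]: "num \<in> borel_measurable ?P"
  proof -
    interpret count: sigma_finite_measure "count_space J"
      by (rule sigma_finite_measure_count_space_countable[OF J])
    have "(\<lambda>(j, z). ennreal (a j) * I j z) \<in> borel_measurable (count_space J \<Otimes>\<^sub>M ?P)"
      by (intro measurable_pair_measure_countable1 J) (simp add: aI_measurable)
    from measurable_pair_swap[OF this]
    have "(\<lambda>(z, j). ennreal (a j) * I j z) \<in> borel_measurable (?P \<Otimes>\<^sub>M count_space J)" by simp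
    then show ?thesis unfolding num_def by (rule count.borel_measurable_nn_integral)
  qed
  have "(\<integral>\<^sup>+z. num z * indicator (- R) z \<partial>?P)
      = (\<integral>\<^sup>+z. \<integral>\<^sup>+j. ennreal (a j) * I j z * indicator (- R) z \<partial>count_space J \<partial>?P)"
    unfolding num_def by (simp add: nn_integral_multc)
  also have "\<dots> = (\<integral>\<^sup>+j. \<integral>\<^sup>+z. ennreal (a j) * I j z * indicator (- R) z \<partial>?P \<partial>count_space J)"
    by (intro nn_integral_count_space_nn_integral J borel_measurable_times_ennreal aI_measurable) auto
  also have "\<dots> \<le> (\<integral>\<^sup>+j. ennreal (v j) \<partial>count_space J)"
  proof (rule nn_integral_mono)
    fix j assume "j \<in> space (count_space J)"
    then have j: "j \<in> J" by simp
    interpret prior: prob_space "prior j" by (rule prior[OF j])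
    interpret pair_prob_space "prior j" ?P ..
    note [measurable] = joint[OF j] far_sets[OF j] I_measurable[OF j]
    note [measurable] = lik_ratio_joint_measurable[OF F[OF j], of n]
    have "(\<integral>\<^sup>+z. I j z * indicator (- R) z \<partial>?P)
        = (\<integral>\<^sup>+z. \<integral>\<^sup>+\<theta>. ennreal (?L j \<theta> z) * indicator (far j) \<theta> * indicator (- R) z \<partial>prior j \<partial>?P)"
      unfolding I_def by (intro nn_integral_cong nn_integral_multc[symmetric]) measurable
    also have "\<dots> = (\<integral>\<^sup>+\<theta>. \<integral>\<^sup>+z. ennreal (?L j \<theta> z) * indicator (far j) \<theta> * indicator (- R) z \<partial>?P \<partial>prior j)"
      by (subst Fubini') auto
    also have "\<dots> \<le> (\<integral>\<^sup>+\<theta>. ennreal (w j) \<partial>prior j)"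
    proof (rule nn_integral_mono)
      fix \<theta> assume "\<theta> \<in> space (prior j)"
      then show "(\<integral>\<^sup>+z. ennreal (?L j \<theta> z) * indicator (far j) \<theta> * indicator (- R) z \<partial>?P) \<le> ennreal (w j)"
        using w[OF j, of \<theta>] by (cases "\<theta> \<in> far j") (auto simp: far_def)
    qed
    also have "\<dots> = ennreal (w j)" by (simp add: prior.emeasure_space_1)
    finally have "(\<integral>\<^sup>+z. I j z * indicator (- R) z \<partial>?P) \<le> ennreal (w j)" .
    then have "ennreal (a j) * (\<integral>\<^sup>+z. I j z * indicator (- R) z \<partial>?P) \<le> ennreal (a j) * ennreal (w j)"
      by (intro mult_left_mono) auto
    also have "\<dots> \<le> ennreal (v j)"
      using a(1)[OF j] w_nonneg[OF j] v(1)[OF j] by (simp add: ennreal_mult[symmetric] ennreal_leI)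
    finally show "(\<integral>\<^sup>+z. ennreal (a j) * I j z * indicator (- R) z \<partial>?P) \<le> ennreal (v j)"
      by (simp add: mult.assoc nn_integral_cmult)
  qed
  also have "\<dots> = ennreal V"
  proof -
    have "v j \<ge> 0" if "j \<in> J" for j
      using v(1)[OF that] mult_nonneg_nonneg[OF a(1)[OF that] w_nonneg[OF that]] by linarith
    with v(2) show ?thesis
      by (simp add: nn_integral_count_space_eq_infsum has_sum_imp_summable infsumI)
  qed
  finally have E_num: "(\<integral>\<^sup>+z. num z * indicator (- R) z \<partial>?P) \<le> ennreal V" .
  have V: "V \<ge> 0"
    using v a(1) w_nonneg by (intro has_sum_nonneg[OF v(2)]) (meson mult_nonneg_nonneg order_trans)
  define K where "K = \<kappa> * a j0 * b"
  have K: "K > 0" using \<kappa> j0 b by (simp add: K_def)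
  \<comment> \<open>\<open>K\<close> is \<open>\<kappa>\<close> times the guaranteed size of the
    denominator. Off \<open>R\<close> and \<open>R'\<close>, a posterior probability above
    \<open>\<kappa>\<close> therefore forces the numerator to be at least \<open>K\<close>, and
    \<open>G\<close> is the event to which Markov's inequality applies.\<close>
  define G where "G = {z\<in>space ?P. 1 \<le> ennreal (1 / K) * (num z * indicator (- R) z)}"
  have G_sets[measurable]: "G \<in> sets ?P" unfolding G_def by measurable
  have "emeasure ?P G \<le> ennreal (1 / K) * (\<integral>\<^sup>+z. num z * indicator (- R) z * indicator (space ?P) z \<partial>?P)"
    unfolding G_def by (rule nn_integral_Markov_inequality) auto
  also have "(\<integral>\<^sup>+z. num z * indicator (- R) z * indicator (space ?P) z \<partial>?P) = (\<integral>\<^sup>+z. num z * indicator (- R) z \<partial>?P)"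
    by (intro nn_integral_cong) simp
  also have "ennreal (1 / K) * \<dots> \<le> ennreal (1 / K) * ennreal V"
    by (intro mult_left_mono E_num) auto
  finally have "ennreal (measure ?P G) \<le> ennreal (V / K)"
    using K V by (simp add: ennreal_mult[symmetric] data.emeasure_eq_measure)
  then have G: "measure ?P G \<le> V / K" using K V by simp
  have "{z\<in>space ?P. posterior_far \<mu> \<sigma> f0 J a prior F s n z > \<kappa>} \<subseteq> R \<union> R' \<union> G"
  proof (rule subsetI, rule ccontr)
    fix z assume "z \<in> {z\<in>space ?P. posterior_far \<mu> \<sigma> f0 J a prior F s n z > \<kappa>}" "z \<notin> R \<union> R' \<union> G"
    then have z: "z \<in> space ?P" "z \<notin> G" "z \<notin> R'" "z \<notin> R"
      and post: "posterior_far \<mu> \<sigma> f0 J a prior F s n z > \<kappa>" by auto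
    \<comment> \<open>Thanks to this common bound, the integrals and infinite sums in
      \<open>posterior_far\<close> are genuine values and not the default 0 for divergent
      ones.\<close>
    define Z where "Z = exp (\<Sum>i<n. (snd (z i) - f0 (fst (z i)))^2 / (2 * \<sigma>^2))"
    have L: "0 \<le> ?L j \<theta> z" "?L j \<theta> z \<le> Z" for j \<theta>
      using lik_ratio_le[of "F j \<theta>" n z] lik_ratio_pos[of "F j \<theta>" n z] by (auto simp: Z_def)
    have Lm: "(\<lambda>\<theta>. ?L j \<theta> z) \<in> borel_measurable (prior j)" if "j \<in> J" for j
      using measurable_Pair2[OF joint[OF that] z(1)] by simp
    define D where "D j = (LINT \<theta>|prior j. ?L j \<theta> z)" for j
    define S where "S j = (LINT \<theta>:far j|prior j. ?L j \<theta> z)" for j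
    have D: "0 \<le> D j" "D j \<le> Z" "integrable (prior j) (\<lambda>\<theta>. ?L j \<theta> z)" if j: "j \<in> J" for j
    proof -
      interpret prior: prob_space "prior j" by (rule prior[OF j])
      show int: "integrable (prior j) (\<lambda>\<theta>. ?L j \<theta> z)"
        using L Lm[OF j] by (intro prior.integrable_const_bound[where B = Z]) auto
      show "0 \<le> D j" unfolding D_def using L by simp
      show "D j \<le> Z" unfolding D_def using prior.integral_le_const[OF int, of Z] L by simp
    qed
    have S: "0 \<le> S j" "S j \<le> D j" "ennreal (S j) = I j z" if j: "j \<in> J" for j
    proof -
      have int: "integrable (prior j) (\<lambda>\<theta>. indicator (far j) \<theta> *\<^sub>R ?L j \<theta> z)"
        using far_sets[OF j] D(3)[OF j] by (rule integrable_mult_indicator)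
      show "0 \<le> S j" unfolding S_def set_lebesgue_integral_def using L by simp
      show "S j \<le> D j" unfolding S_def D_def set_lebesgue_integral_def
        using L by (intro integral_mono int D(3) j) (simp add: indicator_def)
      have "ennreal (S j) = (\<integral>\<^sup>+\<theta>. ennreal (indicator (far j) \<theta> *\<^sub>R ?L j \<theta> z) \<partial>prior j)"
        unfolding S_def set_lebesgue_integral_def
        using L by (intro nn_integral_eq_integral[symmetric] int) simp
      also have "\<dots> = I j z"
        unfolding I_def by (intro nn_integral_cong) (simp add: indicator_def)
      finally show "ennreal (S j) = I j z" .
    qed
    have sumD: "(\<lambda>j. a j * D j) summable_on J"
      using a D by (intro summable_on_comparison_test[OF summable_on_cmult_left[OF a(2), of Z]])
        (auto intro: mult_left_mono)
    have sumS: "(\<lambda>j. a j * S j) summable_on J"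
      using a S by (intro summable_on_comparison_test[OF sumD]) (auto intro: mult_left_mono)
    have num_z: "num z = ennreal (\<Sum>\<^sub>\<infinity>j\<in>J. a j * S j)"
    proof -
      have "num z = (\<integral>\<^sup>+j. ennreal (a j * S j) \<partial>count_space J)"
        unfolding num_def using a S by (intro nn_integral_cong) (simp add: ennreal_mult)
      also have "\<dots> = ennreal (\<Sum>\<^sub>\<infinity>j\<in>J. a j * S j)"
        using a S by (intro nn_integral_count_space_eq_infsum sumS) simp
      finally show ?thesis .
    qed
    have "ennreal b \<le> (\<integral>\<^sup>+\<theta>. ennreal (?L j0 \<theta> z) * indicator B \<theta> \<partial>prior j0)"
      using evidence z by simp
    also have "\<dots> \<le> (\<integral>\<^sup>+\<theta>. ennreal (?L j0 \<theta> z) \<partial>prior j0)"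
      by (intro nn_integral_mono) (simp add: indicator_def)
    also have "\<dots> = ennreal (D j0)"
      unfolding D_def using L D(3)[OF j0(1)] by (intro nn_integral_eq_integral) auto
    finally have "b \<le> D j0" using D(1)[OF j0(1)] by simp
    then have "a j0 * b \<le> a j0 * D j0" using j0 by simp
    also have "\<dots> \<le> (\<Sum>\<^sub>\<infinity>j\<in>J. a j * D j)"
      using finite_sum_le_infsum[OF sumD, of "{j0}"] j0 a D by simp
    finally have den: "a j0 * b \<le> (\<Sum>\<^sub>\<infinity>j\<in>J. a j * D j)" .
    have den_pos: "(\<Sum>\<^sub>\<infinity>j\<in>J. a j * D j) > 0"
      using den mult_pos_pos[OF j0(2) b] by linarith
    have "\<kappa> < (\<Sum>\<^sub>\<infinity>j\<in>J. a j * S j) / (\<Sum>\<^sub>\<infinity>j\<in>J. a j * D j)"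
      using post unfolding posterior_far_def S_def D_def far_def .
    then have "\<kappa> * (\<Sum>\<^sub>\<infinity>j\<in>J. a j * D j) < (\<Sum>\<^sub>\<infinity>j\<in>J. a j * S j)"
      using den_pos by (simp add: pos_less_divide_eq)
    moreover have "\<kappa> * (a j0 * b) \<le> \<kappa> * (\<Sum>\<^sub>\<infinity>j\<in>J. a j * D j)"
      using den \<kappa> by (intro mult_left_mono) auto
    ultimately have "K \<le> (\<Sum>\<^sub>\<infinity>j\<in>J. a j * S j)" by (simp add: K_def mult.assoc)
    then have "1 \<le> 1 / K * (\<Sum>\<^sub>\<infinity>j\<in>J. a j * S j)" using K by (simp add: field_simps)
    then have "1 \<le> ennreal (1 / K) * num z"
      using K unfolding num_z by (subst ennreal_mult'[symmetric]) (auto simp: ennreal_leI[of 1, simplified])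
    with z have "z \<in> G" by (simp add: G_def)
    with z show False by simp
  qed
  then have "measure ?P {z\<in>space ?P. posterior_far \<mu> \<sigma> f0 J a prior F s n z > \<kappa>} \<le> measure ?P (R \<union> R' \<union> G)"
    by (intro data.finite_measure_mono) auto
  also have "\<dots> \<le> measure ?P R + measure ?P R' + measure ?P G"
    using measure_Un_le[of "R \<union> R'" ?P G] measure_Un_le[of R ?P R'] by simp
  also have "\<dots> \<le> measure ?P R + measure ?P R' + V / (\<kappa> * a j0 * b)"
    using G by (simp add: K_def)
  finally show ?thesis .
qed

end

section \<open>Choice of the constants and convergence of the posterior\<close>

theorem theorem2:
  fixes \<mu> :: "'x measure" and f0 :: "'x \<Rightarrow> real" and \<sigma> M \<gamma> \<alpha> :: real
    and J :: "'j set" and \<Theta> :: "'j \<Rightarrow> 'p set" and f :: "'j \<Rightarrow> 'p \<Rightarrow> 'x \<Rightarrow> real"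
    and prior :: "'j \<Rightarrow> 'p measure"
    and A m C \<eta> a :: "'j \<Rightarrow> real"
    and jn :: "nat \<Rightarrow> 'j" and \<beta> :: "nat \<Rightarrow> 'p" and \<epsilon> :: "nat \<Rightarrow> real"
    and d :: "'j \<Rightarrow> 'p \<Rightarrow> 'p \<Rightarrow> real"
    and K0' K4 K5 b1 b2 :: real
  assumes mu: "prob_space \<mu>" and sigma: "\<sigma> > 0" and M: "M > 0"
    and f0_meas: "f0 \<in> borel_measurable \<mu>" and f0_bound: "\<And>x. x \<in> space \<mu> \<Longrightarrow> \<bar>f0 x\<bar> \<le> M"
    and J: "countable J"
    and prior: "\<And>j. j \<in> J \<Longrightarrow> prob_space (prior j)" and prior_space: "\<And>j. j \<in> J \<Longrightarrow> space (prior j) = \<Theta> j"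
    and f_meas: "\<And>j. j \<in> J \<Longrightarrow> (\<lambda>(\<theta>, x). f j \<theta> x) \<in> borel_measurable (prior j \<Otimes>\<^sub>M \<mu>)"
    and f_bound: "\<And>j \<theta> x. j \<in> J \<Longrightarrow> \<theta> \<in> \<Theta> j \<Longrightarrow> x \<in> space \<mu> \<Longrightarrow> \<bar>f j \<theta> x\<bar> \<le> M"
    and gamma: "0 < \<gamma>" "\<gamma> < 0.25"
    "0.0056 = 0.13 / (c2 M \<sigma> * sqrt (c1 M \<sigma>)) * (\<gamma> / sqrt (1 - 4 * \<gamma>))"
    and A: "\<And>j. j \<in> J \<Longrightarrow> A j \<ge> 0.0056" and m: "\<And>j. j \<in> J \<Longrightarrow> m j \<ge> 1"
    and entropy: "\<And>j r \<delta> \<theta>. j \<in> J \<Longrightarrow> r > 0 \<Longrightarrow> 0 < \<delta> \<Longrightarrow> \<delta> \<le> 0.0056 * r \<Longrightarrow> \<theta> \<in> \<Theta> j \<Longrightarrow>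
           ereal_of_enat (covering_number (\<Theta> j)
               (pball (\<Theta> j) (\<lambda>\<theta> \<eta>. L2_dist \<mu> (f j \<theta>) (f j \<eta>)) \<theta> r)
               \<delta> (\<lambda>\<theta> \<eta>. sup_dist \<mu> (f j \<theta>) (f j \<eta>)))
           \<le> ereal ((A j * r / \<delta>) powr m j)"
    and C_nonneg: "\<And>j. j \<in> J \<Longrightarrow> C j \<ge> 0"
    and C_sum: "(\<lambda>j. exp (- C j)) summable_on J" "(\<Sum>\<^sub>\<infinity>j\<in>J. exp (- C j)) \<le> 1"
    and eta: "\<And>j. j \<in> J \<Longrightarrow> \<eta> j = complexity M \<sigma> \<gamma> (A j) (m j) (C j)"
    and weights: "\<And>j. j \<in> J \<Longrightarrow> a j = \<alpha> * exp (- (1 + 1 / (2 * \<sigma>^2) + 0.0056 / \<sigma>) * \<eta> j)"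
    and weights_sum: "(a has_sum 1) J"
    and jn: "\<And>n. n \<ge> 1 \<Longrightarrow> jn n \<in> J" and beta: "\<And>n. n \<ge> 1 \<Longrightarrow> \<beta> n \<in> \<Theta> (jn n)"
    and eps_pos: "\<And>n. n \<ge> 1 \<Longrightarrow> \<epsilon> n > 0"
    and approx: "\<And>n. n \<ge> 1 \<Longrightarrow>
           max (KL_div (\<mu> \<Otimes>\<^sub>M lborel) (reg_density \<sigma> f0) (reg_density \<sigma> (f (jn n) (\<beta> n))))
               (KL_var (\<mu> \<Otimes>\<^sub>M lborel) (reg_density \<sigma> f0) (reg_density \<sigma> (f (jn n) (\<beta> n))))
           + \<eta> (jn n) / real n \<le> (\<epsilon> n)^2"
    and metric: "\<And>n. n \<ge> 1 \<Longrightarrow> Metric_space (\<Theta> (jn n)) (d (jn n))"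
    and L2_le_metric: "\<And>n \<theta> \<eta>. n \<ge> 1 \<Longrightarrow> \<theta> \<in> \<Theta> (jn n) \<Longrightarrow> \<eta> \<in> \<Theta> (jn n) \<Longrightarrow>
           (L2_dist \<mu> (f (jn n) \<theta>) (f (jn n) \<eta>))^2 \<le> K0' * (d (jn n) \<theta> \<eta>)^2"
    and b1: "b1 \<ge> 0" and K4: "K4 > 0"
    and cover: "\<And>n. n \<ge> 1 \<Longrightarrow>
           ereal_of_enat (covering_number (\<Theta> (jn n)) (\<Theta> (jn n)) (\<epsilon> n) (d (jn n)))
           \<le> ereal ((A (jn n) powr b1 * K4) powr m (jn n))"
    and b2: "b2 \<ge> 0" and K5: "K5 > 0"
    and ball_meas: "\<And>n \<theta>. n \<ge> 1 \<Longrightarrow> \<theta> \<in> \<Theta> (jn n) \<Longrightarrow>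
           pball (\<Theta> (jn n)) (d (jn n)) \<theta> (\<epsilon> n) \<in> sets (prior (jn n))"
    and ball_pos: "\<And>n. n \<ge> 1 \<Longrightarrow>
           measure (prior (jn n)) (pball (\<Theta> (jn n)) (d (jn n)) (\<beta> n) (\<epsilon> n)) > 0"
    and ball_ratio: "\<And>n \<theta>. n \<ge> 1 \<Longrightarrow> \<theta> \<in> \<Theta> (jn n) \<Longrightarrow>
           measure (prior (jn n)) (pball (\<Theta> (jn n)) (d (jn n)) \<theta> (\<epsilon> n))
             / measure (prior (jn n)) (pball (\<Theta> (jn n)) (d (jn n)) (\<beta> n) (\<epsilon> n))
           \<le> (A (jn n) powr b2 * K5) powr m (jn n)"
    and eps_lim: "\<epsilon> \<longlonglongrightarrow> 0" and n_eps_lim: "filterlim (\<lambda>n. real n * (\<epsilon> n)^2) at_top sequentially"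
  shows "\<exists>K1>0. \<forall>\<kappa>>0.
    (\<lambda>n. measure (data_law \<mu> \<sigma> f0 n)
           {z \<in> space (data_law \<mu> \<sigma> f0 n). posterior_far \<mu> \<sigma> f0 J a prior f (K1 * \<epsilon> n) n z > \<kappa>})
    \<longlonglongrightarrow> 0"
proof -
  interpret gaussian_regression \<mu> f0 \<sigma> M
    by (intro gaussian_regression.intro gaussian_regression_axioms.intro mu sigma f0_meas f0_bound)
  have reg: "regfun (f j \<theta>)" if "j \<in> J" "\<theta> \<in> \<Theta> j" for j \<theta>
    using measurable_Pair2[OF f_meas[OF that(1)], of \<theta>] f_bound[OF that] prior_space[OF that(1)] that(2)
    by (auto simp: regfun_def)

  \<comment> \<open>The coefficients in \<open>complexity\<close> are \<open>H\<close> and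
    \<open>max 1 (2 * H)\<close>; the maximum with 1 is what gives
    \<open>C j \<le> \<eta> j\<close>.\<close>
  define H where "H = 4 / (c1 M \<sigma> * (1 - 4 * \<gamma>))"
  have H: "H > 0" using c1_pos[OF M sigma] gamma by (simp add: H_def)
  have eta_H: "\<eta> j = H * m j * ln (1072.5 * A j) + C j * max 1 (2 * H)" if "j \<in> J" for j
    unfolding eta[OF that] complexity_def H_def by simp
  \<comment> \<open>At the smallest admissible \<open>A j\<close> the argument is 1072.5 * 0.0056 =
    6.006, which exceeds e. A logarithm of at least 1 lets additive constants be absorbed into
    multiples of \<open>\<eta> j\<close>.\<close>
  have log_A: "ln (1072.5 * A j) \<ge> 1" if "j \<in> J" for j
  proof -
    have "3 \<le> 1072.5 * A j" using A[OF that] by simp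
    with exp_le have "exp 1 \<le> 1072.5 * A j" by (rule order_trans)
    moreover have "0 < 1072.5 * A j" using A[OF that] by simp
    ultimately show ?thesis by (simp only: ln_ge_iff)
  qed
  have eta_ge: "H * (m j * ln (1072.5 * A j)) \<le> \<eta> j" "C j \<le> \<eta> j" "0 \<le> \<eta> j" if j: "j \<in> J" for j
  proof -
    have p: "0 \<le> H * (m j * ln (1072.5 * A j))"
      using H m[OF j] log_A[OF j] by simp
    have "C j * 1 \<le> C j * max 1 (2 * H)" using C_nonneg[OF j] by (intro mult_left_mono) auto
    then show "H * (m j * ln (1072.5 * A j)) \<le> \<eta> j" "C j \<le> \<eta> j" "0 \<le> \<eta> j"
      using p C_nonneg[OF j] unfolding eta_H[OF j] mult.assoc by linarith+
  qed
  \<comment> \<open>The local entropy, the global covering number and the ratio of prior masses are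
    all bounded by powers of this form, hence by exponentials of multiples of the
    complexity.\<close>
  have powr_le: "(A j powr q * K) powr m j \<le> exp ((q + \<bar>ln K\<bar>) / H * \<eta> j)"
    if j: "j \<in> J" and q: "q \<ge> 0" and K: "K > 0" for j q K
  proof -
    have A_pos: "A j > 0" using A[OF j] by simp
    have "ln (A j) \<le> ln (1072.5 * A j)" using A_pos by simp
    then have "q * ln (A j) + ln K \<le> q * ln (1072.5 * A j) + \<bar>ln K\<bar> * 1"
      using q by (intro add_mono mult_left_mono) auto
    also have "\<dots> \<le> q * ln (1072.5 * A j) + \<bar>ln K\<bar> * ln (1072.5 * A j)"
      using log_A[OF j] by (intro add_left_mono mult_left_mono) auto
    finally have "m j * (q * ln (A j) + ln K) \<le> m j * ((q + \<bar>ln K\<bar>) * ln (1072.5 * A j))"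
      using m[OF j] by (intro mult_left_mono) (auto simp: algebra_simps)
    also have "\<dots> = (q + \<bar>ln K\<bar>) / H * (H * (m j * ln (1072.5 * A j)))"
      using H by simp
    also have "\<dots> \<le> (q + \<bar>ln K\<bar>) / H * \<eta> j"
      using H q by (intro mult_left_mono eta_ge j) auto
    finally have "m j * (q * ln (A j) + ln K) \<le> (q + \<bar>ln K\<bar>) / H * \<eta> j" .
    moreover have "(A j powr q * K) powr m j = exp (m j * (q * ln (A j) + ln K))"
      using A_pos K by (simp add: powr_def[of "A j powr q * K"] ln_mult ln_powr)
    ultimately show ?thesis by simp
  qed

  have alpha: "\<alpha> > 0"
  proof (rule ccontr)
    assume "\<not> \<alpha> > 0"
    then have "a j \<le> 0" if "j \<in> J" for j
      unfolding weights[OF that] by (intro mult_nonpos_nonneg) auto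
    from has_sum_mono[OF weights_sum has_sum_0[of J "\<lambda>_. 0"] this] show False by simp
  qed
  have a_pos: "a j > 0" if "j \<in> J" for j
    using alpha by (simp add: weights[OF that])

  define \<tau> where "\<tau> n = real n * (\<epsilon> n)^2" for n
  \<comment> \<open>Both summands in \<open>approx\<close> are nonnegative, so each is at most
    \<open>(\<epsilon> n)^2\<close>; the divergence then turns into an L2 distance.\<close>
  have eta_tau: "\<eta> (jn n) \<le> \<tau> n" and beta_near: "(L2_dist \<mu> (f (jn n) (\<beta> n)) f0)^2 \<le> 2 * \<sigma>^2 * (\<epsilon> n)^2"
    if n: "n \<ge> 1" for n
  proof -
    let ?q = "reg_density \<sigma> (f (jn n) (\<beta> n))"
    have "0 \<le> KL_var (\<mu> \<Otimes>\<^sub>M lborel) (reg_density \<sigma> f0) ?q"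
      unfolding KL_var_def by (intro integral_nonneg_AE) (auto simp: reg_density_def split: prod.split)
    with approx[OF n] have "\<eta> (jn n) / real n \<le> (\<epsilon> n)^2" by linarith
    with n show "\<eta> (jn n) \<le> \<tau> n" by (simp add: \<tau>_def field_simps)
    have "0 \<le> \<eta> (jn n) / real n" using eta_ge(3)[OF jn[OF n]] by simp
    with approx[OF n] have "KL_div (\<mu> \<Otimes>\<^sub>M lborel) (reg_density \<sigma> f0) ?q \<le> (\<epsilon> n)^2" by linarith
    then have "(L2_dist \<mu> f0 (f (jn n) (\<beta> n)))^2 / (2 * \<sigma>^2) \<le> (\<epsilon> n)^2"
      by (simp only: KL_div_reg_density[OF reg[OF jn[OF n] beta[OF n]]])
    with sigma show "(L2_dist \<mu> (f (jn n) (\<beta> n)) f0)^2 \<le> 2 * \<sigma>^2 * (\<epsilon> n)^2"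
      by (simp add: L2_dist_commute[of f0] field_simps)
  qed

  define ball where "ball n = pball (\<Theta> (jn n)) (d (jn n)) (\<beta> n) (\<epsilon> n)" for n
  define Cp where "Cp = (b1 + \<bar>ln K4\<bar>) / H + (b2 + \<bar>ln K5\<bar>) / H"
  have Cp: "Cp \<ge> 0" using H b1 b2 by (simp add: Cp_def)
  \<comment> \<open>The covering balls have total mass at least 1, and each weighs at most a
    controlled multiple of the ball around \<open>\<beta> n\<close>; so the number of balls, this
    multiple and the mass sought have a product of at least 1.\<close>
  have ball_mass: "exp (- (Cp * \<tau> n)) \<le> measure (prior (jn n)) (ball n)" if n: "n \<ge> 1" for n
  proof -
    let ?j = "jn n" and ?\<pi> = "prior (jn n)"
    note j = jn[OF n]
    interpret prior: prob_space ?\<pi> by (rule prior[OF j])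
    obtain S where S: "finite S" "S \<subseteq> \<Theta> ?j" "\<Theta> ?j \<subseteq> (\<Union>\<theta>\<in>S. pball (\<Theta> ?j) (d ?j) \<theta> (\<epsilon> n))"
      "real (card S) \<le> (A ?j powr b1 * K4) powr m ?j"
      using covering_number_le_obtain[OF cover[OF n]] .
    define p where "p = measure ?\<pi> (ball n)"
    have p: "p > 0" using ball_pos[OF n] by (simp add: p_def ball_def)
    have "1 = measure ?\<pi> (\<Theta> ?j)" using prior.prob_space prior_space[OF j] by simp
    also have "\<dots> \<le> measure ?\<pi> (\<Union>\<theta>\<in>S. pball (\<Theta> ?j) (d ?j) \<theta> (\<epsilon> n))"
      using S ball_meas[OF n] by (intro prior.finite_measure_mono sets.finite_UN) auto
    also have "\<dots> \<le> (\<Sum>\<theta>\<in>S. measure ?\<pi> (pball (\<Theta> ?j) (d ?j) \<theta> (\<epsilon> n)))"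
      using S ball_meas[OF n] by (intro measure_UNION_le) auto
    also have "\<dots> \<le> (\<Sum>\<theta>\<in>S. (A ?j powr b2 * K5) powr m ?j * p)"
    proof (rule sum_mono)
      fix \<theta> assume "\<theta> \<in> S"
      with S(2) have "\<theta> \<in> \<Theta> ?j" by auto
      from ball_ratio[OF n this] p
      show "measure ?\<pi> (pball (\<Theta> ?j) (d ?j) \<theta> (\<epsilon> n)) \<le> (A ?j powr b2 * K5) powr m ?j * p"
        by (simp add: p_def ball_def pos_divide_le_eq)
    qed
    also have "\<dots> = real (card S) * (A ?j powr b2 * K5) powr m ?j * p" by simp
    also have "\<dots> \<le> (A ?j powr b1 * K4) powr m ?j * (A ?j powr b2 * K5) powr m ?j * p"
      using S(4) p by (intro mult_right_mono) auto
    also have "\<dots> \<le> exp ((b1 + \<bar>ln K4\<bar>) / H * \<eta> ?j) * exp ((b2 + \<bar>ln K5\<bar>) / H * \<eta> ?j) * p"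
      using p by (intro mult_right_mono mult_mono powr_le j b1 b2 K4 K5) auto
    also have "\<dots> = exp (Cp * \<eta> ?j) * p" by (simp add: Cp_def exp_add[symmetric] distrib_right)
    also have "\<dots> \<le> exp (Cp * \<tau> n) * p"
      using Cp p eta_tau[OF n] by (auto intro!: mult_right_mono mult_left_mono)
    finally show ?thesis by (simp add: p_def exp_minus field_simps)
  qed

  \<comment> \<open>Twice the squared L2 radius of the ball plus twice the squared distance from
    \<open>\<beta> n\<close> to \<open>f0\<close>, in units of \<open>(\<epsilon> n)^2\<close>. The
    absolute value covers either sign of \<open>K0'\<close>.\<close>
  define c0 where "c0 = 2 * \<bar>K0'\<bar> + 4 * \<sigma>^2"
  have ball_near: "(L2_dist \<mu> (f (jn n) \<theta>) f0)^2 \<le> c0 * (\<epsilon> n)^2" if n: "n \<ge> 1" and th: "\<theta> \<in> ball n" for n \<theta>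
  proof -
    have thT: "\<theta> \<in> \<Theta> (jn n)" and dist: "d (jn n) (\<beta> n) \<theta> \<le> \<epsilon> n"
      using th by (auto simp: ball_def pball_def)
    note j = jn[OF n] and bT = beta[OF n]
    have "0 \<le> d (jn n) (\<beta> n) \<theta>" using metric[OF n] by (rule Metric_space.nonneg)
    then have dist2: "(d (jn n) (\<beta> n) \<theta>)^2 \<le> (\<epsilon> n)^2" using dist by (intro power_mono)
    have "(L2_dist \<mu> (f (jn n) \<theta>) (f (jn n) (\<beta> n)))^2 \<le> K0' * (d (jn n) (\<beta> n) \<theta>)^2"
      using L2_le_metric[OF n bT thT] by (simp add: L2_dist_commute)
    also have "\<dots> \<le> \<bar>K0'\<bar> * (d (jn n) (\<beta> n) \<theta>)^2" by (intro mult_right_mono) auto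
    also have "\<dots> \<le> \<bar>K0'\<bar> * (\<epsilon> n)^2" by (intro mult_left_mono dist2) auto
    finally show ?thesis
      using L2_dist_sq_triangle[OF reg[OF j thT] reg[OF j bT] regfun_f0] beta_near[OF n]
      by (simp add: c0_def algebra_simps)
  qed

  define w where "w = 1 / (2 * \<sigma>^2) + 0.0056 / \<sigma>"
  have w: "w > 0" using sigma by (simp add: w_def add_pos_pos)
  have a_eq: "a j = \<alpha> * exp (- ((1 + w) * \<eta> j))" if "j \<in> J" for j
    unfolding weights[OF that] w_def by (simp add: algebra_simps)
  \<comment> \<open>\<open>Ce\<close> is the exponent lost by the evidence relative to the ball
    mass, its extra 1 paying for the exceptional event. \<open>Cb\<close> adds the exponents of the
    ball mass and of the model weight, so it is the total cost of the denominator.\<close>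
  define Ce where "Ce = chi_const * c0 + 1"
  define Cb where "Cb = Ce + Cp + (1 + w)"
  have Ce: "Ce \<ge> 1" using chi_const_pos by (simp add: Ce_def c0_def)
  have Cb: "Cb \<ge> 2" using Ce Cp w by (simp add: Cb_def)
  \<comment> \<open>Solves \<open>w * L = Cb + 1\<close>: above the cutoff
    \<open>L * \<tau> n\<close>, the surplus in the weight beats the denominator by a factor
    \<open>exp (- \<tau> n)\<close>.\<close>
  define L where "L = (Cb + 1) / w"
  have L: "L > 0" using Cb w by (simp add: L_def)
  \<comment> \<open>0.02 lies below \<open>0.0056 * 4\<close>, the limit that the entropy assumption
    sets for covering a ball of radius \<open>4 * r\<close>; the other term is dictated by the
    test.\<close>
  define \<kappa>0 where "\<kappa>0 = min 0.02 (\<sigma> * sqrt (\<rho> / 8))"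
  have k0: "\<kappa>0 > 0" "\<kappa>0 \<le> 1 / 2" "\<kappa>0 \<le> 0.0056 * 4" "8 * \<kappa>0^2 \<le> \<rho> * \<sigma>^2"
  proof -
    show pos: "\<kappa>0 > 0" using sigma rho_pos by (simp add: \<kappa>0_def)
    show "\<kappa>0 \<le> 1 / 2" "\<kappa>0 \<le> 0.0056 * 4" by (auto simp: \<kappa>0_def min_def)
    have "\<kappa>0^2 \<le> (\<sigma> * sqrt (\<rho> / 8))^2" using pos by (intro power_mono) (auto simp: \<kappa>0_def)
    also have "\<dots> = \<sigma>^2 * (\<rho> / 8)" using rho_pos by (simp add: power_mult_distrib)
    finally show "8 * \<kappa>0^2 \<le> \<rho> * \<sigma>^2" by (simp add: mult.commute)
  qed
  \<comment> \<open>Ball and cover radii have the fixed ratio \<open>4 / \<kappa>0\<close>, so the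
    exponent for the number of centres is free of \<open>r\<close>.\<close>
  define Cs where "Cs = (1 + \<bar>ln (4 / \<kappa>0)\<bar>) / H"
  have Cs: "Cs \<ge> 0" using H by (simp add: Cs_def)
  have local_cover: "\<exists>S. finite S \<and> S \<subseteq> \<Theta> j \<and> real (card S) \<le> exp (Cs * \<eta> j) \<and>
        pball (\<Theta> j) (\<lambda>\<theta> \<eta>. L2_dist \<mu> (f j \<theta>) (f j \<eta>)) \<theta> (4 * r)
          \<subseteq> (\<Union>\<eta>\<in>S. pball (\<Theta> j) (\<lambda>\<theta> \<eta>. sup_dist \<mu> (f j \<theta>) (f j \<eta>)) \<eta> (\<kappa>0 * r))"
    if j: "j \<in> J" and r: "r > 0" and th: "\<theta> \<in> \<Theta> j" for j r \<theta>
  proof -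
    have "\<kappa>0 * r \<le> 0.0056 * (4 * r)" using k0(3) r by (simp add: mult_right_mono mult.assoc[symmetric])
    moreover have "4 * r > 0" "\<kappa>0 * r > 0" using r k0 by auto
    ultimately obtain S where S: "finite S" "S \<subseteq> \<Theta> j"
        "pball (\<Theta> j) (\<lambda>\<theta> \<eta>. L2_dist \<mu> (f j \<theta>) (f j \<eta>)) \<theta> (4 * r)
          \<subseteq> (\<Union>\<eta>\<in>S. pball (\<Theta> j) (\<lambda>\<theta> \<eta>. sup_dist \<mu> (f j \<theta>) (f j \<eta>)) \<eta> (\<kappa>0 * r))"
        "real (card S) \<le> (A j * (4 * r) / (\<kappa>0 * r)) powr m j"
      using covering_number_le_obtain[OF entropy[OF j _ _ _ th]] by metis
    have "A j * (4 * r) / (\<kappa>0 * r) = A j powr 1 * (4 / \<kappa>0)" using r k0 A[OF j] by simp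
    with S(4) have "real (card S) \<le> (A j powr 1 * (4 / \<kappa>0)) powr m j" by simp
    also have "\<dots> \<le> exp (Cs * \<eta> j)"
      unfolding Cs_def using k0 by (intro powr_le j) auto
    finally show ?thesis using S by blast
  qed

  \<comment> \<open>Type II errors \<open>exp (- (Q * \<tau> n))\<close> have to beat the
    denominator; type I errors of order \<open>exp (- (2 * Q * \<tau> n))\<close> have to beat
    \<open>exp (L * \<tau> n)\<close> models times \<open>exp (L * Cs * \<tau> n)\<close>
    centres.\<close>
  define Q where "Q = Cb + 1 + L * (1 + Cs)"
  have Q: "Q \<ge> Cb + 1" "2 * Q \<ge> L * (1 + Cs) + 1"
    using Cb mult_nonneg_nonneg[of L "1 + Cs"] L Cs unfolding Q_def by auto
  define K1 where "K1 = sqrt (8 * Q / \<rho>)"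
  have K1: "K1 > 0" using Q Cb rho_pos by (simp add: K1_def)
  have K1_sq: "real n * \<rho> * (K1 * \<epsilon> n)^2 = 8 * Q * \<tau> n" for n
    using Q Cb rho_pos by (simp add: K1_def \<tau>_def power_mult_distrib)

  \<comment> \<open>In the factor 3, two units come from the type I errors and one from the
    exceptional event of the evidence; the fraction comes from Markov's inequality for the
    numerator.\<close>
  have bound: "measure (data_law \<mu> \<sigma> f0 n)
      {z\<in>space (data_law \<mu> \<sigma> f0 n). posterior_far \<mu> \<sigma> f0 J a prior f (K1 * \<epsilon> n) n z > \<kappa>}
    \<le> (3 + (1 + \<alpha>) / (\<kappa> * \<alpha>)) * exp (- \<tau> n)"
    if n: "n \<ge> 1" and tau: "\<tau> n \<ge> 1" and kappa: "\<kappa> > 0" for n \<kappa>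
  proof -
    let ?P = "data_law \<mu> \<sigma> f0 n" and ?s = "K1 * \<epsilon> n" and ?\<tau> = "\<tau> n"
    note j = jn[OF n]
    interpret data: prob_space ?P by (rule prob_space_data)
    have s: "?s > 0" using K1 eps_pos[OF n] by simp
    have s4: "real n * \<rho> * ?s^2 / 4 = 2 * Q * ?\<tau>" and s8: "real n * \<rho> * ?s^2 / 8 = Q * ?\<tau>"
      unfolding K1_sq by simp_all
    \<comment> \<open>This is where \<open>\<tau> n \<ge> 1\<close> matters: it brings the ratio of
      the geometric series over the shells down to 1/2.\<close>
    have "1 \<le> 2 * Q * ?\<tau>" using Q Cb tau mult_mono[of 1 "2 * Q" 1 ?\<tau>] by simp
    moreover have "exp (-1) \<le> (1/2 :: real)" using exp_ge_add_one_self[of "1::real"] by (simp add: exp_minus field_simps)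
    ultimately have large: "exp (- (2 * Q * ?\<tau>)) \<le> 1 / 2" by (smt (verit) exp_le_cancel_iff)

    define t where "t = exp (- (Ce * ?\<tau>))"
    have t: "t = exp (- (real n * chi_const * (c0 * (\<epsilon> n)^2) + ?\<tau>))"
      by (simp add: t_def Ce_def \<tau>_def algebra_simps)
    have ball: "ball n \<in> sets (prior (jn n))" "measure (prior (jn n)) (ball n) > 0" "ball n \<subseteq> \<Theta> (jn n)"
      using ball_meas[OF n beta[OF n]] ball_pos[OF n] by (auto simp: ball_def pball_def)
    obtain R' where R': "R' \<in> sets ?P" "emeasure ?P R' \<le> ennreal (exp (- ?\<tau>))"
      "\<And>z. z \<in> space ?P \<Longrightarrow> z \<notin> R' \<Longrightarrow> ennreal (t * measure (prior (jn n)) (ball n))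
        \<le> (\<integral>\<^sup>+\<theta>. ennreal (lik_ratio \<sigma> f0 (f (jn n) \<theta>) n z) * indicator (ball n) \<theta> \<partial>prior (jn n))"
    proof (rule evidence_lower_bound[OF prior[OF j] f_meas[OF j] ball(1,2) _ _ t])
      show "regfun (f (jn n) \<theta>)" if "\<theta> \<in> ball n" for \<theta> using reg[OF j] ball(3) that by auto
    qed (use ball_near[OF n] in auto)

    define J' where "J' = {j\<in>J. \<eta> j < L * ?\<tau>}"
    have J': "finite J'" "real (card J') \<le> exp (L * ?\<tau>)"
      using finite_card_le_of_exp_sum[OF C_sum, of J' "L * ?\<tau>"] eta_ge(2) by (fastforce simp: J'_def)+
    let ?N = "exp (Cs * (L * ?\<tau>))"
    define good where "good j R \<longleftrightarrow> R \<in> sets ?P \<and> emeasure ?P R \<le> ennreal (2 * ?N * exp (- (2 * Q * ?\<tau>))) \<and>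
      (\<forall>\<theta>\<in>\<Theta> j. L2_dist \<mu> (f j \<theta>) f0 > ?s \<longrightarrow>
        (\<integral>\<^sup>+z. ennreal (lik_ratio \<sigma> f0 (f j \<theta>) n z) * indicator (- R) z \<partial>?P) \<le> ennreal (exp (- (Q * ?\<tau>))))"
      for j R
    have "\<exists>R. good j R"
      if j: "j \<in> J'" for j
    proof -
      have jJ: "j \<in> J" and small: "\<eta> j < L * ?\<tau>" using j by (auto simp: J'_def)
      have N: "exp (Cs * \<eta> j) \<le> ?N" using small Cs by (simp add: mult_left_mono)
      have N_cover: "\<exists>S. finite S \<and> S \<subseteq> \<Theta> j \<and> real (card S) \<le> ?N \<and>
        pball (\<Theta> j) (\<lambda>\<theta> \<eta>. L2_dist \<mu> (f j \<theta>) (f j \<eta>)) \<theta> (4 * r)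
          \<subseteq> (\<Union>\<eta>\<in>S. pball (\<Theta> j) (\<lambda>\<theta> \<eta>. sup_dist \<mu> (f j \<theta>) (f j \<eta>)) \<eta> (\<kappa>0 * r))"
        if "r > 0" "\<theta> \<in> \<Theta> j" for r \<theta>
        using local_cover[OF jJ that] N by (meson order_trans)
      have N_nonneg: "0 \<le> ?N" by simp
      have large': "exp (- (real n * \<rho> * ?s^2 / 4)) \<le> 1 / 2" unfolding s4 by (rule large)
      from exists_test[where T = "\<Theta> j" and F = "f j" and n = n,
          OF reg[OF jJ] s k0(1,2,4) N_nonneg N_cover large']
      show ?thesis unfolding s4 s8 good_def Bex_def .
    qed
    then obtain R0 where "\<And>j. j \<in> J' \<Longrightarrow> good j (R0 j)" by metis
    then have R0: "\<And>j. j \<in> J' \<Longrightarrow> R0 j \<in> sets ?P"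
      "\<And>j. j \<in> J' \<Longrightarrow> emeasure ?P (R0 j) \<le> ennreal (2 * ?N * exp (- (2 * Q * ?\<tau>)))"
      "\<And>j \<theta>. j \<in> J' \<Longrightarrow> \<theta> \<in> \<Theta> j \<Longrightarrow> L2_dist \<mu> (f j \<theta>) f0 > ?s \<Longrightarrow>
        (\<integral>\<^sup>+z. ennreal (lik_ratio \<sigma> f0 (f j \<theta>) n z) * indicator (- R0 j) z \<partial>?P) \<le> ennreal (exp (- (Q * ?\<tau>)))"
      by (simp_all add: good_def)
    define R where "R = (\<Union>j\<in>J'. R0 j)"
    have R_sets: "R \<in> sets ?P" unfolding R_def using R0(1) J' by (intro sets.finite_UN) auto
    have "measure ?P R \<le> (\<Sum>j\<in>J'. measure ?P (R0 j))"
      unfolding R_def using R0(1) J' by (intro measure_UNION_le) auto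
    also have "\<dots> \<le> (\<Sum>j\<in>J'. 2 * ?N * exp (- (2 * Q * ?\<tau>)))"
      using R0(2) by (intro sum_mono) (simp add: data.emeasure_eq_measure)
    also have "\<dots> = real (card J') * (2 * ?N * exp (- (2 * Q * ?\<tau>)))" by simp
    also have "\<dots> \<le> exp (L * ?\<tau>) * (2 * ?N * exp (- (2 * Q * ?\<tau>)))"
      using J' by (intro mult_right_mono) auto
    also have "\<dots> = 2 * exp ((L * (1 + Cs) - 2 * Q) * ?\<tau>)"
      by (simp add: mult_exp_exp algebra_simps)
    also have "\<dots> \<le> 2 * exp (- ?\<tau>)"
      using Q(2) tau mult_right_mono[of "L * (1 + Cs) - 2 * Q" "-1" ?\<tau>] by simp
    finally have R_small: "measure ?P R \<le> 2 * exp (- ?\<tau>)" .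

    define e where "e = exp (- ((Cb + 1) * ?\<tau>))"
    \<comment> \<open>Models above the cutoff are not tested; for them the mean 1 of the likelihood
      ratio is the bound.\<close>
    define u where "u j = (if j \<in> J' then e else 1)" for j
    have tests: "(\<integral>\<^sup>+z. ennreal (lik_ratio \<sigma> f0 (f j \<theta>) n z) * indicator (- R) z \<partial>?P) \<le> ennreal (u j)"
      if jJ: "j \<in> J" and th: "\<theta> \<in> space (prior j)" and far: "L2_dist \<mu> (f j \<theta>) f0 > ?s" for j \<theta>
    proof (cases "j \<in> J'")
      case True
      have "(\<integral>\<^sup>+z. ennreal (lik_ratio \<sigma> f0 (f j \<theta>) n z) * indicator (- R) z \<partial>?P)
        \<le> (\<integral>\<^sup>+z. ennreal (lik_ratio \<sigma> f0 (f j \<theta>) n z) * indicator (- R0 j) z \<partial>?P)"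
        using True by (intro nn_integral_mono) (auto simp: R_def indicator_def)
      also have "\<dots> \<le> ennreal (exp (- (Q * ?\<tau>)))"
        using R0(3)[OF True _ far] th prior_space[OF jJ] by simp
      also have "\<dots> \<le> ennreal (u j)"
        using True Q(1) tau by (auto simp: u_def e_def intro!: ennreal_leI mult_right_mono)
      finally show ?thesis .
    next
      case False
      have "(\<integral>\<^sup>+z. ennreal (lik_ratio \<sigma> f0 (f j \<theta>) n z) * indicator (- R) z \<partial>?P)
        \<le> (\<integral>\<^sup>+z. ennreal (lik_ratio \<sigma> f0 (f j \<theta>) n z) \<partial>?P)"
        by (intro nn_integral_mono) (simp add: indicator_def)
      also have "\<dots> = 1" using th prior_space[OF jJ] by (intro lik_ratio_mean reg jJ) simp
      finally show ?thesis using False by (simp add: u_def)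
    qed
    \<comment> \<open>One summable majorant for both kinds of models: the first term covers the
      tested ones, the second those above the cutoff.\<close>
    define v where "v j = e * (a j + \<alpha> * exp (- C j))" for j
    have au: "a j * u j \<le> v j" if jJ: "j \<in> J" for j
    proof (cases "j \<in> J'")
      case True
      with alpha show ?thesis by (simp add: u_def v_def e_def algebra_simps)
    next
      case False
      with jJ have big: "L * ?\<tau> \<le> \<eta> j" by (simp add: J'_def)
      have "(Cb + 1) * ?\<tau> = w * (L * ?\<tau>)" using w by (simp add: L_def)
      also have "\<dots> \<le> w * \<eta> j" using w big by (intro mult_left_mono) auto
      finally have "(Cb + 1) * ?\<tau> + C j \<le> (1 + w) * \<eta> j"
        using eta_ge(2)[OF jJ] by (simp add: distrib_right)
      then have "exp (- ((1 + w) * \<eta> j)) \<le> e * exp (- C j)"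
        unfolding e_def by (simp add: mult_exp_exp)
      then have "a j \<le> \<alpha> * (e * exp (- C j))"
        unfolding a_eq[OF jJ] using alpha by (intro mult_left_mono) auto
      moreover have "0 \<le> e * a j" using a_pos[OF jJ] by (simp add: e_def)
      ultimately show ?thesis using False by (simp add: u_def v_def algebra_simps)
    qed
    define V where "V = e * (1 + \<alpha> * (\<Sum>\<^sub>\<infinity>j\<in>J. exp (- C j)))"
    have V: "(v has_sum V) J"
      unfolding v_def V_def
      by (intro has_sum_cmult_right has_sum_add weights_sum has_sum_infsum C_sum)
    have V_le: "V \<le> e * (1 + \<alpha>)"
      unfolding V_def using C_sum(2) alpha by (intro mult_left_mono add_left_mono) (auto simp: e_def)
    let ?b = "t * measure (prior (jn n)) (ball n)"
    have b: "?b > 0" using ball by (simp add: t_def)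
    have main: "measure ?P {z\<in>space ?P. posterior_far \<mu> \<sigma> f0 J a prior f ?s n z > \<kappa>}
      \<le> measure ?P R + measure ?P R' + V / (\<kappa> * a (jn n) * ?b)"
      using tests au a_pos a_pos[OF j] R'(3) ball(3) prior_space[OF j]
      by (intro posterior_far_prob_le[where w = u and v = v and B = "ball n"] J prior f_meas R_sets R'(1) V j b kappa
          has_sum_imp_summable[OF weights_sum]) (auto simp: u_def e_def less_imp_le)
    \<comment> \<open>The cost \<open>Cb\<close> is split back into its three sources: model weight,
      evidence level and prior mass of the ball.\<close>
    have "\<alpha> * exp (- (Cb * ?\<tau>)) = (\<alpha> * exp (- ((1 + w) * ?\<tau>))) * (t * exp (- (Cp * ?\<tau>)))"
      by (simp add: t_def mult_exp_exp Cb_def algebra_simps)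
    also have "\<dots> \<le> a (jn n) * ?b"
      unfolding a_eq[OF j] using alpha w eta_tau[OF n] ball_mass[OF n]
      by (intro mult_mono mult_left_mono) (auto simp: t_def intro!: mult_nonneg_nonneg)
    finally have "\<kappa> * (\<alpha> * exp (- (Cb * ?\<tau>))) \<le> \<kappa> * (a (jn n) * ?b)"
      using kappa by (intro mult_left_mono) auto
    then have "V / (\<kappa> * a (jn n) * ?b) \<le> (e * (1 + \<alpha>)) / (\<kappa> * (\<alpha> * exp (- (Cb * ?\<tau>))))"
      using V_le alpha kappa by (intro frac_le) (auto simp: e_def mult.assoc)
    also have "\<dots> = (1 + \<alpha>) / (\<kappa> * \<alpha>) * (e / exp (- (Cb * ?\<tau>)))"
      by (simp add: mult_ac)
    also have "e / exp (- (Cb * ?\<tau>)) = exp (- ?\<tau>)"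
      unfolding e_def exp_diff[symmetric] by (simp add: algebra_simps)
    finally have "V / (\<kappa> * a (jn n) * ?b) \<le> (1 + \<alpha>) / (\<kappa> * \<alpha>) * exp (- ?\<tau>)" .
    moreover have "measure ?P R' \<le> exp (- ?\<tau>)"
      using R'(2) by (simp add: data.emeasure_eq_measure)
    ultimately show ?thesis using main R_small by (simp add: distrib_right)
  qed

  show ?thesis
  proof (intro exI[of _ K1] conjI allI impI K1)
    fix \<kappa> :: real assume kappa: "\<kappa> > 0"
    have tau_lim: "filterlim \<tau> at_top sequentially" using n_eps_lim unfolding \<tau>_def .
    have "((\<lambda>n. exp (- \<tau> n)) \<longlongrightarrow> 0) sequentially"
      by (intro filterlim_compose[OF exp_at_bot] filterlim_compose[OF filterlim_uminus_at_bot_at_top] tau_lim)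
    then have lim: "(\<lambda>n. (3 + (1 + \<alpha>) / (\<kappa> * \<alpha>)) * exp (- \<tau> n)) \<longlonglongrightarrow> 0"
      using tendsto_mult_right_zero by blast
    have ev: "\<forall>\<^sub>F n in sequentially. n \<ge> 1 \<and> \<tau> n \<ge> 1"
      using tau_lim eventually_ge_at_top[of "1::nat"] by (auto simp: filterlim_at_top intro: eventually_conj)
    show "(\<lambda>n. measure (data_law \<mu> \<sigma> f0 n)
           {z \<in> space (data_law \<mu> \<sigma> f0 n). posterior_far \<mu> \<sigma> f0 J a prior f (K1 * \<epsilon> n) n z > \<kappa>})
      \<longlonglongrightarrow> 0"
    proof (rule tendsto_sandwich[OF _ _ tendsto_const lim])
      show "\<forall>\<^sub>F n in sequentially. measure (data_law \<mu> \<sigma> f0 n)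
           {z \<in> space (data_law \<mu> \<sigma> f0 n). posterior_far \<mu> \<sigma> f0 J a prior f (K1 * \<epsilon> n) n z > \<kappa>}
        \<le> (3 + (1 + \<alpha>) / (\<kappa> * \<alpha>)) * exp (- \<tau> n)"
        using ev by eventually_elim (use bound kappa in blast)
    qed simp
  qed
qed

end
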